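(* Let $n, T \ge 1$ and $\epsilon \in \left(\frac{\log^4 n}{\sqrt{n}}, \frac12\right)$. No online learning algorithm for the experts problem with $n$ experts and $T$ days that uses space $o\left(\frac{\sqrt{n}}{\epsilon\log^3 n}\right)$ can achieve regret at most $\frac{\epsilon^2}{20}T$ against every adaptive adversary.
   Context: Online learning with expert advice: there are $n$ experts and $T$ days. The algorithm starts with a memory state $M_0$. On day $t\in[T]$ the algorithm picks an expert $i_t\in[n]$ based on its memory state $M_{t-1}$ (and internal randomness); then a loss vector $\ell_t\in[0,1]^n$ is revealed; the algorithm incurs loss $\ell_t(i_t)$, observes $\ell_t$, and updates its memory state to $M_t$. The space used is $\max_t |M_t|$ (in words). An adaptive adversary chooses $\ell_t$ at the beginning of day $t$, possibly depending on the algorithm's past actions $i_1,\dots,i_{t-1}$. The regret is $\mathbb{E}\left[\sum_{t=1}^T\ell_t(i_t) - \min_{i^*\in[n]}\sum_{t=1}^T\ell_t(i^* )\right]$, the expectation over the randomness of the algorithm and of the adversary. *)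

theory Defs
  imports "HOL-Probability.Probability" "HOL-Library.Monad_Syntax" "HOL-Library.Landau_Symbols"
begin

(* Experts are 0, ..., n - 1 and days are 1, ..., T.  A loss vector is an element of [0,1]^n,
   represented as an extensional function on {..<n}. *)

type_synonym loss = "nat \<Rightarrow> real"

definition loss_vectors :: "nat \<Rightarrow> loss set" where
  "loss_vectors n = ({..<n} \<rightarrow>\<^sub>E {0..1})"

(* A memory state is a list of machine words; a word of b bits is a number below 2^b. *)

type_synonym memory = "nat list"

definition memory_states :: "nat \<Rightarrow> memory set" where
  "memory_states b = lists {..<2 ^ b}"

(* On day t the expert i_t is drawn from pick t M_{t-1}, and the new state M_t from
   update t M_{t-1} i_t l_t.  Letting the update see i_t accounts for internal randomness of day t
   that is used both to choose i_t and to compute M_t; randomness of a day is available on later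
   days only through the memory state.  The rules may depend on t (and on n and T, which are fixed
   before the algorithm is) free of charge. *)

record experts_algorithm =
  init :: "memory pmf"
  pick :: "nat \<Rightarrow> memory \<Rightarrow> nat pmf"
  update :: "nat \<Rightarrow> memory \<Rightarrow> nat \<Rightarrow> loss \<Rightarrow> memory pmf"

definition online_algorithm :: "nat \<Rightarrow> nat \<Rightarrow> experts_algorithm \<Rightarrow> bool" where
  "online_algorithm n b alg \<longleftrightarrow>
     set_pmf (init alg) \<subseteq> memory_states b \<and>
     (\<forall>t. \<forall>m \<in> memory_states b. set_pmf (pick alg t m) \<subseteq> {..<n}) \<and>
     (\<forall>t. \<forall>m \<in> memory_states b. \<forall>i < n. \<forall>l \<in> loss_vectors n.
        set_pmf (update alg t m i l) \<subseteq> memory_states b)"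

(* The adversary draws l_t given the past actions [i_1, ..., i_{t-1}] and its own past choices
   [l_1, ..., l_{t-1}]; it sees neither i_t nor the memory states. *)

type_synonym adversary = "nat list \<Rightarrow> loss list \<Rightarrow> loss pmf"

definition adaptive_adversary :: "nat \<Rightarrow> adversary \<Rightarrow> bool" where
  "adaptive_adversary n adv \<longleftrightarrow> (\<forall>as ls. set_pmf (adv as ls) \<subseteq> loss_vectors n)"

(* The joint law of ([M_0, ..., M_T], [i_1, ..., i_T], [l_1, ..., l_T]). *)

primrec play ::
  "experts_algorithm \<Rightarrow> adversary \<Rightarrow> nat \<Rightarrow> (memory list \<times> nat list \<times> loss list) pmf" where
  "play alg adv 0 = map_pmf (\<lambda>m. ([m], [], [])) (init alg)"
| "play alg adv (Suc t) = do {
     (ms, as, ls) \<leftarrow> play alg adv t;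
     l \<leftarrow> adv as ls;
     i \<leftarrow> pick alg (Suc t) (last ms);
     m \<leftarrow> update alg (Suc t) (last ms) i l;
     return_pmf (ms @ [m], as @ [i], ls @ [l])
   }"

definition space_used :: "memory list \<Rightarrow> nat" where
  "space_used ms = Max (length ` set ms)"

(* The space bound has to hold against every adversary and for every outcome of the coins. *)

definition uses_space_at_most :: "nat \<Rightarrow> nat \<Rightarrow> experts_algorithm \<Rightarrow> real \<Rightarrow> bool" where
  "uses_space_at_most n T alg s \<longleftrightarrow>
     (\<forall>adv. adaptive_adversary n adv \<longrightarrow>
        (\<forall>(ms, as, ls) \<in> set_pmf (play alg adv T). real (space_used ms) \<le> s))"

definition realized_regret :: "nat \<Rightarrow> nat list \<Rightarrow> loss list \<Rightarrow> real" where
  "realized_regret n as ls =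
     (\<Sum>t<length ls. (ls ! t) (as ! t)) - (MIN i\<in>{..<n}. \<Sum>t<length ls. (ls ! t) i)"

definition regret :: "nat \<Rightarrow> nat \<Rightarrow> experts_algorithm \<Rightarrow> adversary \<Rightarrow> real" where
  "regret n T alg adv =
     measure_pmf.expectation (play alg adv T) (\<lambda>(ms, as, ls). realized_regret n as ls)"

(* The filter "n tends to infinity, uniformly in T and eps" on the admissible triples (n, T, eps):
   asymptotic notation for a function of all three parameters is understood along it. *)

definition admissible :: "(nat \<times> nat \<times> real) set" where
  "admissible =
     {(n, T, eps). 1 \<le> n \<and> 1 \<le> T \<and> ln (real n) ^ 4 / sqrt (real n) < eps \<and> eps < 1 / 2}"

definition large_n :: "(nat \<times> nat \<times> real) filter" where
  "large_n = inf (filtercomap fst at_top) (principal admissible)"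

end

theory Submission
  imports Defs
begin

text \<open>
  Let \<open>x = sqrt n / eps\<close> and let the memory have \<open>N = exp (o(x))\<close> states.  A random set of about \<open>x\<close> experts
  is permanently good, and in each epoch of \<open>B = floor x\<close> days an independent set of the same density
  \<open>p = x / n\<close> serves as decoys.  On each day, with probability \<open>1 - q\<close> all losses vanish, and with probability
  \<open>q = 4 * eps^2\<close> they are coins, biased towards 0 exactly for the good experts and decoys that have
  not been played yet in the current epoch.

  An epoch spoils only the good experts that are played in it, so if the algorithm seldom hits a good
  expert or a decoy, then the average permanently good expert beats it by a constant times \<open>q\<close> per day.
  Hits are rare for two reasons.  By a level-1 inequality, planting a bias at a random expert
  changes the evolution of a memory with \<open>N\<close> states by at most \<open>O(q * ln N)\<close> per day, summed over all
  experts; so fresh decoys are hardly ever found.  And given the union of good experts and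
  decoys, the two kinds are exchangeable, so the at most \<open>ln N\<close> nats remembered from earlier
  epochs hardly help to tell them apart.\<close>

section \<open>Expectations and states with few values\<close>

text \<open>The good experts are fixed for the whole game, so the memory at the start of a later
  epoch may depend on them, and a bound for a freshly planted bias does not apply to them. Decoys
  are redrawn in each epoch, hence independent of that memory; they are bounded directly and the
  good experts only by comparison. Switching off the bias of a played expert lets the algorithm
  profit from each target at most once per epoch, so its gain is a count of first hits; past actions
  enter the losses only in this way. The level-1 inequality controls squares of influences, whereas
  hit probabilities change linearly in them, and Cauchy-Schwarz would give
  \<open>sqrt (n * ln N)\<close> instead of \<open>ln N\<close>; hence the potential
  \<open>bend\<close>. The parameters satisfy \<open>p * q * x = 4\<close>, so fresh hits per day
  are of order \<open>p + ln N / x\<close>. Telling good experts from decoys adds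
  \<open>ln N / s + s * x\<close> hits per epoch, little when spread over about \<open>x\<close>
  days with a small constant \<open>s\<close>.\<close>

abbreviation E :: "'a pmf \<Rightarrow> ('a \<Rightarrow> real) \<Rightarrow> real" where
  "E p f \<equiv> measure_pmf.expectation p f"

lemma E_mono:
  assumes "finite (set_pmf p)" "\<And>x. x \<in> set_pmf p \<Longrightarrow> f x \<le> g x"
  shows "E p f \<le> E p g"
  using assms by (intro integral_mono_AE integrable_measure_pmf_finite) (auto simp: AE_measure_pmf_iff)

lemma E_cong: "(\<And>x. x \<in> set_pmf p \<Longrightarrow> f x = g x) \<Longrightarrow> E p f = E p g"
  by (intro integral_cong_AE) (auto simp: AE_measure_pmf_iff)

lemma E_add: "finite (set_pmf p) \<Longrightarrow> E p (\<lambda>x. f x + g x) = E p f + E p g"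
  by (intro Bochner_Integration.integral_add integrable_measure_pmf_finite)

lemma E_diff: "finite (set_pmf p) \<Longrightarrow> E p (\<lambda>x. f x - g x) = E p f - E p g"
  by (intro Bochner_Integration.integral_diff integrable_measure_pmf_finite)

lemma E_sum: "finite (set_pmf p) \<Longrightarrow> E p (\<lambda>x. \<Sum>i\<in>I. f i x) = (\<Sum>i\<in>I. E p (f i))"
  by (intro Bochner_Integration.integral_sum integrable_measure_pmf_finite)

lemma E_finite:
  assumes "finite A" "set_pmf p \<subseteq> A"
  shows "E p f = (\<Sum>a\<in>A. pmf p a * f a)"
  by (subst integral_measure_pmf_real[OF assms(1)]) (use assms in \<open>auto simp: mult.commute\<close>)

lemma E_bind:
  assumes "finite (set_pmf p)" "\<And>x. x \<in> set_pmf p \<Longrightarrow> finite (set_pmf (f x))"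
  shows "E (bind_pmf p f) h = E p (\<lambda>x. E (f x) h)"
  by (subst pmf_expectation_bind[OF assms(1)]) (use assms in \<open>auto simp: E_finite[OF assms(1) subset_refl]\<close>)

lemma E_le_const:
  assumes "finite (set_pmf p)" "\<And>x. x \<in> set_pmf p \<Longrightarrow> f x \<le> c"
  shows "E p f \<le> c"
  using E_mono[OF assms(1), of f "\<lambda>_. c"] assms(2) by simp

lemma E_ge_const:
  assumes "finite (set_pmf p)" "\<And>x. x \<in> set_pmf p \<Longrightarrow> c \<le> f x"
  shows "c \<le> E p f"
  using E_mono[OF assms(1), of "\<lambda>_. c" f] assms(2) by simp

lemma E_square_le:
  assumes "finite (set_pmf p)"
  shows "(E p f)\<^sup>2 \<le> E p (\<lambda>x. (f x)\<^sup>2)"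
proof -
  have "0 \<le> E p (\<lambda>x. (f x - E p f)\<^sup>2)" by simp
  also have "\<dots> = E p (\<lambda>x. (f x)\<^sup>2) - (E p f)\<^sup>2"
    using assms by (simp add: measure_pmf.variance_eq integrable_measure_pmf_finite)
  finally show ?thesis by simp
qed

text \<open>Hoeffding's lemma for a fair sign: the library fact is used with success probability 1/2
  and width \<open>2 * x\<close>, then exponentiated.\<close>

lemma exp_average_le:
  fixes x :: real
  shows "(exp x + exp (- x)) / 2 \<le> exp (x\<^sup>2 / 2)"
proof -
  have *: "(exp x + exp (- x)) / 2 \<le> exp (x\<^sup>2 / 2)" if "x \<ge> 0" for x :: real
  proof -
    have "- (2 * x) * (1/2) + ln (1 + 1/2 * (exp (2 * x) - 1)) \<le> (2 * x)\<^sup>2 / 8"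
      using Hoeffdings_lemma_aux[of "2 * x" "1 / 2"] that by simp
    hence "ln (1 + 1/2 * (exp (2 * x) - 1)) \<le> x + x\<^sup>2 / 2" by (simp add: power2_eq_square)
    moreover have "0 < 1 + 1/2 * (exp (2 * x) - 1)"
      using exp_gt_zero[of "2 * x"] by (simp add: field_simps del: exp_gt_zero)
    ultimately have "1 + 1/2 * (exp (2 * x) - 1) \<le> exp (x + x\<^sup>2 / 2)"
      by (metis exp_le_cancel_iff exp_ln)
    hence "exp (- x) * (1 + 1/2 * (exp (2 * x) - 1)) \<le> exp (- x) * exp (x + x\<^sup>2 / 2)"
      by (intro mult_left_mono) auto
    also have "exp (- x) * exp (x + x\<^sup>2 / 2) = exp (x\<^sup>2 / 2)" by (simp flip: exp_add)
    also have "exp (- x) * (1 + 1/2 * (exp (2 * x) - 1)) = (exp x + exp (- x)) / 2"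
      by (simp add: algebra_simps add_divide_distrib flip: exp_add)
    finally show ?thesis .
  qed
  show ?thesis using *[of x] *[of "-x"] by (cases "x \<ge> 0") (auto simp: add.commute)
qed

text \<open>The index \<open>m\<close> may be selected after seeing \<open>x\<close>, but only among
  \<open>N\<close> values, and this freedom costs \<open>ln N\<close>. Both information bounds rest
  on it: the level-1 inequality and the comparison of good experts with decoys.\<close>

lemma expectation_maximal:
  assumes fin: "finite (set_pmf p)" "finite M" "real (card M) \<le> N" "1 \<le> N"
    and U: "\<And>x. x \<in> set_pmf p \<Longrightarrow> set_pmf (U x) \<subseteq> M"
    and Z: "\<And>m. m \<in> M \<Longrightarrow> E p (\<lambda>x. exp (Z m x)) \<le> 1"
  shows "E p (\<lambda>x. E (U x) (\<lambda>m. Z m x)) \<le> ln N"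
proof -
  have finU: "finite (set_pmf (U x))" if "x \<in> set_pmf p" for x
    using U[OF that] fin(2) finite_subset by blast
  have eN: "exp (Z m x - ln N) = exp (Z m x) / N" for m x
    using fin(4) by (simp add: exp_diff)
  have "E p (\<lambda>x. E (U x) (\<lambda>m. Z m x)) \<le> E p (\<lambda>x. (\<Sum>m\<in>M. exp (Z m x) / N) + (ln N - 1))"
  proof (rule E_mono[OF fin(1)])
    fix x assume x: "x \<in> set_pmf p"
    have "E (U x) (\<lambda>m. Z m x) \<le> E (U x) (\<lambda>m. exp (Z m x) / N + (ln N - 1))"
    proof (rule E_mono[OF finU[OF x]])
      fix m
      \<comment> \<open>The tangent of \<open>exp z / N\<close> at \<open>z = ln N\<close>; the
        factor \<open>1 / N\<close> later keeps the sum over all of \<open>M\<close> below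
        1.\<close>
      show "Z m x \<le> exp (Z m x) / N + (ln N - 1)"
        using exp_ge_add_one_self[of "Z m x - ln N"] eN[of m x] by simp
    qed
    also have "\<dots> = E (U x) (\<lambda>m. exp (Z m x) / N) + (ln N - 1)"
      by (simp add: E_add[OF finU[OF x]])
    also have "E (U x) (\<lambda>m. exp (Z m x) / N) = (\<Sum>m\<in>M. pmf (U x) m * (exp (Z m x) / N))"
      by (rule E_finite[OF fin(2) U[OF x]])
    also have "\<dots> \<le> (\<Sum>m\<in>M. exp (Z m x) / N)"
      by (intro sum_mono mult_left_le_one_le) (use fin(4) in \<open>auto simp: pmf_le_1\<close>)
    finally show "E (U x) (\<lambda>m. Z m x) \<le> (\<Sum>m\<in>M. exp (Z m x) / N) + (ln N - 1)" by simp
  qed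
  also have "\<dots> = (\<Sum>m\<in>M. E p (\<lambda>x. exp (Z m x)) / N) + (ln N - 1)"
    by (simp add: E_add[OF fin(1)] E_sum[OF fin(1)])
  also have "(\<Sum>m\<in>M. E p (\<lambda>x. exp (Z m x)) / N) \<le> (\<Sum>m\<in>M. 1 / N)"
    by (intro sum_mono divide_right_mono Z) (use fin(4) in auto)
  also have "\<dots> \<le> 1" using fin by (simp add: field_simps)
  finally show ?thesis by simp
qed

text \<open>
  The convexity of \<open>bend\<close> leaves a multiple of the variance of \<open>v\<close> to spare, which pays for the
  correlation of \<open>v\<close> with the tilt in \<open>bend_tilt\<close>.\<close>

definition bend :: "real \<Rightarrow> real" where
  "bend v = v + v\<^sup>2 / 2"

lemma bend_ge: "v \<le> bend v"
  by (simp add: bend_def)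

lemma E_bend_ge:
  assumes "finite (set_pmf p)"
  shows "bend (E p f) \<le> E p (\<lambda>x. bend (f x))"
  using E_square_le[OF assms, of f] by (simp add: bend_def E_add[OF assms])

lemma bend_convex:
  assumes "0 \<le> q" "q \<le> 1"
  shows "bend (q * x + (1 - q) * y) \<le> q * bend x + (1 - q) * bend y"
  using E_bend_ge[of "bernoulli_pmf q" "\<lambda>c. if c then x else y"] assms by (simp add: mult.commute)

text \<open>In the application \<open>a\<close> is the law of the memory state and
  \<open>x m\<close> the mean of the tilt variable given state \<open>m\<close>, so the argument of
  \<open>bend\<close> on the left is the mean of \<open>v\<close> under the tilted law.\<close>

lemma bend_tilt:
  fixes a x v :: "'m \<Rightarrow> real"
  assumes "finite M" "\<And>m. m \<in> M \<Longrightarrow> 0 \<le> a m" "(\<Sum>m\<in>M. a m) = 1" "(\<Sum>m\<in>M. a m * x m) = 0"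
    "\<And>m. m \<in> M \<Longrightarrow> \<bar>x m\<bar> \<le> 1" "\<And>m. m \<in> M \<Longrightarrow> 0 \<le> v m" "\<And>m. m \<in> M \<Longrightarrow> v m \<le> 1"
  shows "bend ((\<Sum>m\<in>M. a m * v m) + (\<Sum>m\<in>M. a m * x m * v m) / 2)
    \<le> (\<Sum>m\<in>M. a m * bend (v m)) + 2/3 * (\<Sum>m\<in>M. a m * (x m)\<^sup>2)"
proof -
  define b where "b = (\<Sum>m\<in>M. a m * v m)"
  define D where "D = (\<Sum>m\<in>M. a m * x m * v m)"
  define Vr where "Vr = (\<Sum>m\<in>M. a m * (v m - b)\<^sup>2)"
  define Q where "Q = (\<Sum>m\<in>M. a m * (x m)\<^sup>2)"
  have b: "0 \<le> b" "b \<le> 1"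
  proof -
    show "0 \<le> b" unfolding b_def by (intro sum_nonneg mult_nonneg_nonneg assms)
    have "b \<le> (\<Sum>m\<in>M. a m * 1)" unfolding b_def by (intro sum_mono mult_left_mono assms)
    thus "b \<le> 1" using assms(3) by simp
  qed
  have D_eq: "D = (\<Sum>m\<in>M. a m * (x m * (v m - b)))"
  proof -
    have "(\<Sum>m\<in>M. a m * (x m * (v m - b))) = D - b * (\<Sum>m\<in>M. a m * x m)"
      unfolding D_def by (simp add: sum_subtractf algebra_simps sum_distrib_left)
    thus ?thesis using assms(4) by simp
  qed
  have Vr_eq: "Vr = (\<Sum>m\<in>M. a m * (v m)\<^sup>2) - b\<^sup>2"
  proof -
    have "Vr = (\<Sum>m\<in>M. a m * (v m)\<^sup>2 - 2 * b * (a m * v m) + b\<^sup>2 * a m)"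
      unfolding Vr_def by (intro sum.cong refl) (simp add: power2_eq_square algebra_simps)
    also have "\<dots> = (\<Sum>m\<in>M. a m * (v m)\<^sup>2) - 2 * b * b + b\<^sup>2 * 1"
      unfolding b_def using assms(3) by (simp add: sum.distrib sum_subtractf flip: sum_distrib_left)
    finally show ?thesis by (simp add: power2_eq_square)
  qed
  \<comment> \<open>Young's inequality with weights dictated by the budget: \<open>bend\<close>
    yields \<open>Vr / 2\<close>, the term \<open>D^2 / 8\<close> consumes \<open>Vr / 8\<close>,
    and the remaining 3/8 forces the factor 2/3 in front of \<open>Q\<close>.\<close>
  have absD: "\<bar>D\<bar> \<le> 2/3 * Q + 3/8 * Vr"
  proof -
    have "\<bar>D\<bar> \<le> (\<Sum>m\<in>M. \<bar>a m * (x m * (v m - b))\<bar>)" unfolding D_eq by (rule sum_abs)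
    also have "\<dots> \<le> (\<Sum>m\<in>M. a m * (2/3 * (x m)\<^sup>2 + 3/8 * (v m - b)\<^sup>2))"
    proof (rule sum_mono)
      fix m assume m: "m \<in> M"
      have "0 \<le> (4 * \<bar>x m\<bar> - 3 * \<bar>v m - b\<bar>)\<^sup>2" by simp
      hence "\<bar>x m * (v m - b)\<bar> \<le> 2/3 * (x m)\<^sup>2 + 3/8 * (v m - b)\<^sup>2"
        by (simp add: power2_diff[of "4 * \<bar>x m\<bar>"] abs_mult power_mult_distrib)
      thus "\<bar>a m * (x m * (v m - b))\<bar> \<le> a m * (2/3 * (x m)\<^sup>2 + 3/8 * (v m - b)\<^sup>2)"
        using assms(2)[OF m] by (simp add: abs_mult mult_left_mono)
    qed
    also have "\<dots> = 2/3 * Q + 3/8 * Vr"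
      unfolding Q_def Vr_def by (simp add: sum.distrib distrib_left sum_distrib_left algebra_simps)
    finally show ?thesis .
  qed
  have "0 \<le> (\<Sum>m\<in>M. a m * (x m * (v m - b) - D)\<^sup>2)"
    by (intro sum_nonneg mult_nonneg_nonneg assms) auto
  also have "\<dots> = (\<Sum>m\<in>M. a m * (x m * (v m - b))\<^sup>2 - 2 * D * (a m * (x m * (v m - b))) + D\<^sup>2 * a m)"
    by (intro sum.cong refl) (simp add: power2_eq_square algebra_simps)
  also have "\<dots> = (\<Sum>m\<in>M. a m * (x m * (v m - b))\<^sup>2) - D\<^sup>2"
    using assms(3) D_eq
    by (simp add: sum.distrib sum_subtractf power2_eq_square flip: sum_distrib_left)
  also have "(\<Sum>m\<in>M. a m * (x m * (v m - b))\<^sup>2) \<le> Vr"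
    unfolding Vr_def
  proof (intro sum_mono mult_left_mono assms(2))
    fix m assume m: "m \<in> M"
    show "(x m * (v m - b))\<^sup>2 \<le> (v m - b)\<^sup>2"
      using assms(5)[OF m] by (auto simp: power_mult_distrib abs_square_le_1 intro: mult_left_le_one_le)
  qed
  finally have D2: "D\<^sup>2 \<le> Vr" by simp
  have "D / 2 * (1 + b) \<le> \<bar>D\<bar> / 2 * (1 + b)" by (intro mult_right_mono) (use b in auto)
  also have "\<dots> \<le> \<bar>D\<bar> / 2 * 2" by (intro mult_left_mono) (use b in auto)
  finally have "D / 2 * (1 + b) \<le> 2/3 * Q + 3/8 * Vr" using absD by simp
  moreover have "bend (b + D / 2) = b + D / 2 * (1 + b) + b\<^sup>2 / 2 + D\<^sup>2 / 8"
    by (simp add: bend_def power2_eq_square field_simps)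
  moreover have "(\<Sum>m\<in>M. a m * bend (v m)) = b + (Vr + b\<^sup>2) / 2"
    unfolding Vr_eq bend_def by (simp add: b_def distrib_left sum.distrib sum_divide_distrib)
  ultimately show ?thesis using D2 unfolding b_def[symmetric] D_def[symmetric] Q_def[symmetric] by argo
qed

text \<open>
  Tilting the law of \<open>l\<close> by \<open>1 + r i l / 2\<close> moves the mean of \<open>v i\<close> by half the correlation of
  \<open>v i\<close> with \<open>r i\<close> given the state.  The squared correlations sum to at most \<open>2 ln N\<close>
  (the level-1 inequality), since the state takes only \<open>N\<close> values.\<close>

lemma sum_bend_tilt:
  fixes p :: "'l pmf" and U :: "'l \<Rightarrow> 'm pmf" and r :: "'i \<Rightarrow> 'l \<Rightarrow> real"
  assumes fin: "finite (set_pmf p)" "finite M" "real (card M) \<le> N" "1 \<le> N"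
    and U: "\<And>l. l \<in> set_pmf p \<Longrightarrow> set_pmf (U l) \<subseteq> M"
    and r: "\<And>i l. i \<in> I \<Longrightarrow> l \<in> set_pmf p \<Longrightarrow> \<bar>r i l\<bar> \<le> 1"
    and r0: "\<And>i. i \<in> I \<Longrightarrow> E p (r i) = 0"
    and sub: "\<And>c. E p (\<lambda>l. exp ((\<Sum>i\<in>I. c i * r i l) - (\<Sum>i\<in>I. (c i)\<^sup>2) / 2)) \<le> 1"
    and v: "\<And>i m. i \<in> I \<Longrightarrow> m \<in> M \<Longrightarrow> 0 \<le> v i m \<and> v i m \<le> 1"
  shows "(\<Sum>i\<in>I. bend (E p (\<lambda>l. (1 + r i l / 2) * E (U l) (v i))))
    \<le> (\<Sum>i\<in>I. E p (\<lambda>l. E (U l) (\<lambda>m. bend (v i m)))) + 4/3 * ln N"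
proof -
  define a where "a m = E p (\<lambda>l. pmf (U l) m)" for m
  define b where "b i m = E p (\<lambda>l. r i l * pmf (U l) m)" for i m
  \<comment> \<open>This is the mean of \<open>r i\<close> given state \<open>m\<close>. At a state
    of probability 0 the division gives 0, which is consistent because \<open>b i m\<close> vanishes
    there too.\<close>
  define \<rho> where "\<rho> i m = b i m / a m" for i m
  have EE: "E p (\<lambda>l. f l * E (U l) g) = (\<Sum>m\<in>M. g m * E p (\<lambda>l. f l * pmf (U l) m))" for f g
  proof -
    have "E p (\<lambda>l. f l * E (U l) g) = E p (\<lambda>l. \<Sum>m\<in>M. g m * (f l * pmf (U l) m))"
      by (rule E_cong) (simp add: E_finite[OF fin(2) U] sum_distrib_left algebra_simps)
    thus ?thesis by (simp add: E_sum[OF fin(1)])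
  qed
  have a0: "0 \<le> a m" for m unfolding a_def by simp
  have b_le: "\<bar>b i m\<bar> \<le> a m" if i: "i \<in> I" for i m
  proof -
    have "b i m \<le> a m" unfolding a_def b_def
    proof (rule E_mono[OF fin(1)])
      fix l assume "l \<in> set_pmf p"
      hence "r i l * pmf (U l) m \<le> 1 * pmf (U l) m"
        using r[OF i] by (intro mult_right_mono) (auto simp: abs_le_iff)
      thus "r i l * pmf (U l) m \<le> pmf (U l) m" by simp
    qed
    moreover have "- a m \<le> b i m"
    proof -
      have "E p (\<lambda>l. - pmf (U l) m) \<le> b i m" unfolding b_def
      proof (rule E_mono[OF fin(1)])
        fix l assume "l \<in> set_pmf p"
        hence "(- 1) * pmf (U l) m \<le> r i l * pmf (U l) m"
          using r[OF i] by (intro mult_right_mono) (auto simp: abs_le_iff)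
        thus "- pmf (U l) m \<le> r i l * pmf (U l) m" by simp
      qed
      thus ?thesis by (simp add: a_def)
    qed
    ultimately show ?thesis by simp
  qed
  have b_eq: "b i m = a m * \<rho> i m" if "i \<in> I" for i m
    using b_le[OF that, of m] by (cases "a m = 0") (auto simp: \<rho>_def)
  have \<rho>_le: "\<bar>\<rho> i m\<bar> \<le> 1" if "i \<in> I" for i m
    using b_le[OF that, of m] a0[of m] by (auto simp: \<rho>_def abs_divide divide_le_eq)
  have sum_a: "(\<Sum>m\<in>M. a m) = 1"
    using EE[of "\<lambda>_. 1" "\<lambda>_. 1"] by (simp add: a_def)
  have sum_b: "(\<Sum>m\<in>M. a m * \<rho> i m) = 0" if "i \<in> I" for i
    using EE[of "r i" "\<lambda>_. 1"] r0[OF that] by (simp add: b_def[symmetric] b_eq[OF that])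
  define Q where "Q = (\<Sum>i\<in>I. \<Sum>m\<in>M. a m * (\<rho> i m)\<^sup>2)"
  have "Q \<le> 2 * ln N"
  proof -
    \<comment> \<open>The multipliers in \<open>sub\<close> are the conditional means at
      \<open>m\<close> themselves; the quadratic correction then cancels half of the linear term and
      leaves \<open>Q / 2\<close>.\<close>
    define Z where "Z m l = (\<Sum>i\<in>I. \<rho> i m * r i l) - (\<Sum>i\<in>I. (\<rho> i m)\<^sup>2) / 2" for m l
    have "E p (\<lambda>l. exp (Z m l)) \<le> 1" for m
      unfolding Z_def by (rule sub)
    hence "E p (\<lambda>l. E (U l) (\<lambda>m. Z m l)) \<le> ln N"
      by (intro expectation_maximal[OF fin U])
    also have "E p (\<lambda>l. E (U l) (\<lambda>m. Z m l)) = E p (\<lambda>l. \<Sum>m\<in>M. pmf (U l) m * Z m l)"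
      by (rule E_cong) (simp add: E_finite[OF fin(2) U])
    also have "\<dots> = (\<Sum>m\<in>M. E p (\<lambda>l. pmf (U l) m * Z m l))" by (rule E_sum[OF fin(1)])
    also have "\<dots> = (\<Sum>m\<in>M. (\<Sum>i\<in>I. a m * (\<rho> i m)\<^sup>2) / 2)"
    proof (rule sum.cong[OF refl])
      fix m
      have "E p (\<lambda>l. pmf (U l) m * Z m l)
          = E p (\<lambda>l. (\<Sum>i\<in>I. \<rho> i m * (r i l * pmf (U l) m)) - (\<Sum>i\<in>I. (\<rho> i m)\<^sup>2) / 2 * pmf (U l) m)"
        by (rule E_cong) (simp add: Z_def sum_distrib_left algebra_simps)
      also have "\<dots> = (\<Sum>i\<in>I. \<rho> i m * b i m) - (\<Sum>i\<in>I. (\<rho> i m)\<^sup>2) / 2 * a m"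
        by (simp add: E_diff[OF fin(1)] E_sum[OF fin(1)] a_def b_def)
      also have "(\<Sum>i\<in>I. \<rho> i m * b i m) = (\<Sum>i\<in>I. a m * (\<rho> i m)\<^sup>2)"
        by (intro sum.cong refl) (simp add: b_eq power2_eq_square)
      also have "(\<Sum>i\<in>I. (\<rho> i m)\<^sup>2) / 2 * a m = (\<Sum>i\<in>I. a m * (\<rho> i m)\<^sup>2) / 2"
        by (simp add: sum_distrib_left mult.commute[of _ "a m"])
      finally show "E p (\<lambda>l. pmf (U l) m * Z m l) = (\<Sum>i\<in>I. a m * (\<rho> i m)\<^sup>2) / 2" by simp
    qed
    also have "\<dots> = Q / 2" unfolding Q_def by (subst sum.swap) (simp add: sum_divide_distrib)
    finally show ?thesis by simp
  qed
  have "(\<Sum>i\<in>I. bend (E p (\<lambda>l. (1 + r i l / 2) * E (U l) (v i))))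
      \<le> (\<Sum>i\<in>I. E p (\<lambda>l. E (U l) (\<lambda>m. bend (v i m))) + 2/3 * (\<Sum>m\<in>M. a m * (\<rho> i m)\<^sup>2))"
  proof (rule sum_mono)
    fix i assume i: "i \<in> I"
    have "E p (\<lambda>l. (1 + r i l / 2) * E (U l) (v i)) = E p (\<lambda>l. 1 * E (U l) (v i)) + E p (\<lambda>l. r i l * E (U l) (v i)) / 2"
      by (simp add: E_add[OF fin(1)] distrib_right)
    also have "\<dots> = (\<Sum>m\<in>M. a m * v i m) + (\<Sum>m\<in>M. a m * \<rho> i m * v i m) / 2"
      unfolding EE by (simp add: a_def[symmetric] b_def[symmetric] b_eq[OF i] mult.commute)
    finally have 1: "E p (\<lambda>l. (1 + r i l / 2) * E (U l) (v i)) = \<dots>" .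
    have 2: "E p (\<lambda>l. E (U l) (\<lambda>m. bend (v i m))) = (\<Sum>m\<in>M. a m * bend (v i m))"
      using EE[of "\<lambda>_. 1" "\<lambda>m. bend (v i m)"] by (simp add: a_def mult.commute)
    show "bend (E p (\<lambda>l. (1 + r i l / 2) * E (U l) (v i)))
        \<le> E p (\<lambda>l. E (U l) (\<lambda>m. bend (v i m))) + 2/3 * (\<Sum>m\<in>M. a m * (\<rho> i m)\<^sup>2)"
      unfolding 1 2
      by (rule bend_tilt) (use fin(2) a0 sum_a sum_b[OF i] \<rho>_le[OF i] v[OF i] in auto)
  qed
  also have "\<dots> = (\<Sum>i\<in>I. E p (\<lambda>l. E (U l) (\<lambda>m. bend (v i m)))) + 2/3 * Q"
    by (simp add: Q_def sum.distrib sum_distrib_left)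
  finally show ?thesis using \<open>Q \<le> 2 * ln N\<close> by simp
qed

section \<open>Detecting a planted bias within an epoch\<close>

definition bit_vectors :: "nat \<Rightarrow> loss set" where
  "bit_vectors n = ({..<n} \<rightarrow>\<^sub>E {0, 1})"

text \<open>The bias 1/4 makes the density of a good coin relative to a fair one equal to
  \<open>1 + (1 - 2 * l i) / 2\<close>, the tilt of \<open>sum_bend_tilt\<close> with a sign as
  \<open>r i\<close>. The default \<open>undefined\<close> makes the vectors extensional.\<close>

definition coin_losses :: "nat \<Rightarrow> nat set \<Rightarrow> loss pmf" where
  "coin_losses n A =
     Pi_pmf {..<n} undefined (\<lambda>i. map_pmf of_bool (bernoulli_pmf (if i \<in> A then 1 / 4 else 1 / 2)))"

definition day_losses :: "nat \<Rightarrow> real \<Rightarrow> nat set \<Rightarrow> loss pmf" where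
  "day_losses n q A =
     bind_pmf (bernoulli_pmf q) (\<lambda>c. if c then coin_losses n A else return_pmf (\<lambda>i\<in>{..<n}. 0))"

lemma finite_bit_vectors [simp]: "finite (bit_vectors n)"
  unfolding bit_vectors_def by (intro finite_PiE) auto

lemma bit_vectors_subset: "bit_vectors n \<subseteq> loss_vectors n"
  unfolding bit_vectors_def loss_vectors_def by (intro PiE_mono) auto

lemma zero_in_bit_vectors: "(\<lambda>i\<in>{..<n}. 0) \<in> bit_vectors n"
  unfolding bit_vectors_def by auto

lemma bit_vectors_cases: "l \<in> bit_vectors n \<Longrightarrow> i < n \<Longrightarrow> l i = 0 \<or> l i = 1"
  unfolding bit_vectors_def by (auto simp: PiE_iff)

lemma set_coin_losses: "set_pmf (coin_losses n A) \<subseteq> bit_vectors n"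
proof -
  have "set_pmf (coin_losses n A) \<subseteq> PiE_dflt {..<n} undefined
    (set_pmf \<circ> (\<lambda>i. map_pmf of_bool (bernoulli_pmf (if i \<in> A then 1 / 4 else 1 / 2 :: real))))"
    unfolding coin_losses_def by (rule set_Pi_pmf_subset') simp
  also have "\<dots> \<subseteq> bit_vectors n"
    by (auto simp: PiE_dflt_def bit_vectors_def PiE_iff extensional_def)
  finally show ?thesis .
qed

lemma finite_coin_losses [simp]: "finite (set_pmf (coin_losses n A))"
  by (rule finite_subset[OF set_coin_losses finite_bit_vectors])

lemma set_day_losses: "set_pmf (day_losses n q A) \<subseteq> bit_vectors n"
  unfolding day_losses_def set_bind_pmf
  by (rule UN_least) (use set_coin_losses[of n A] zero_in_bit_vectors in simp)

lemma finite_day_losses [simp]: "finite (set_pmf (day_losses n q A))"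
  by (rule finite_subset[OF set_day_losses finite_bit_vectors])

lemma E_day_losses:
  assumes "0 \<le> q" "q \<le> 1"
  shows "E (day_losses n q A) g = q * E (coin_losses n A) g + (1 - q) * g (\<lambda>i\<in>{..<n}. 0)"
  unfolding day_losses_def using assms by (subst E_bind) (auto simp: mult.commute)

lemma pmf_map_of_bool: "pmf (map_pmf of_bool p :: real pmf) (of_bool c) = pmf p c"
  by (rule pmf_map_inj') (auto simp: inj_def)

lemma E_coin_losses_tilt:
  assumes i: "i < n" "i \<notin> A"
  shows "E (coin_losses n (insert i A)) g = E (coin_losses n A) (\<lambda>l. (1 + (1 - 2 * l i) / 2) * g l)"
proof -
  have "pmf (coin_losses n (insert i A)) l = pmf (coin_losses n A) l * (1 + (1 - 2 * l i) / 2)"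
    if l: "l \<in> bit_vectors n" for l
  proof -
    define c :: "nat set \<Rightarrow> nat \<Rightarrow> real pmf"
      where "c A k = map_pmf of_bool (bernoulli_pmf (if k \<in> A then 1 / 4 else 1 / 2))" for A k
    have pmf: "pmf (coin_losses n A) l = pmf (c A i) (l i) * (\<Prod>k\<in>{..<n}-{i}. pmf (c A k) (l k))" for A
    proof -
      have "pmf (coin_losses n A) l = (\<Prod>k<n. pmf (c A k) (l k))"
        unfolding coin_losses_def c_def
        by (rule pmf_Pi') (use l in \<open>auto simp: bit_vectors_def PiE_iff extensional_def\<close>)
      thus ?thesis using i by (simp add: prod.remove[of _ i])
    qed
    have rest: "(\<Prod>k\<in>{..<n}-{i}. pmf (c (insert i A) k) (l k)) = (\<Prod>k\<in>{..<n}-{i}. pmf (c A k) (l k))"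
      by (rule prod.cong) (auto simp: c_def)
    have "l i = of_bool False \<or> l i = of_bool True"
      using bit_vectors_cases[OF l i(1)] by simp
    hence "pmf (c (insert i A) i) (l i) = pmf (c A i) (l i) * (1 + (1 - 2 * l i) / 2)"
      using i(2) by (elim disjE) (simp_all only: c_def pmf_map_of_bool, simp_all)
    thus ?thesis unfolding pmf rest by simp
  qed
  thus ?thesis
    by (simp add: E_finite[OF finite_bit_vectors set_coin_losses] algebra_simps)
qed

lemma E_coin_losses_component:
  assumes "i < n"
  shows "E (coin_losses n A) (\<lambda>l. f (l i)) = (if i \<in> A then (f 1 + 3 * f 0) / 4 else (f 1 + f 0) / 2)"
proof -
  have "E (coin_losses n A) (\<lambda>l. f (l i)) = E (map_pmf (\<lambda>l. l i) (coin_losses n A)) f" by simp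
  also have "map_pmf (\<lambda>l. l i) (coin_losses n A)
      = map_pmf of_bool (bernoulli_pmf (if i \<in> A then 1 / 4 else 1 / 2))"
    unfolding coin_losses_def using assms by (subst Pi_pmf_component) auto
  finally show ?thesis by (cases "i \<in> A") (simp_all add: field_simps)
qed

text \<open>Outside \<open>A\<close> the signs \<open>1 - 2 * l i\<close> are independent and fair,
  so the expectation factorises and each factor is bounded by \<open>exp_average_le\<close>. This
  supplies the premise \<open>sub\<close> of \<open>sum_bend_tilt\<close>.\<close>

lemma coin_losses_subgaussian:
  assumes I: "I \<subseteq> {..<n} - A"
  shows "E (coin_losses n A) (\<lambda>l. exp ((\<Sum>i\<in>I. c i * (1 - 2 * l i)) - (\<Sum>i\<in>I. (c i)\<^sup>2) / 2)) \<le> 1"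
proof -
  define f where "f i y = (if i \<in> I then exp (c i * (1 - 2 * y) - (c i)\<^sup>2 / 2) else 1)" for i and y :: real
  have fI: "finite I" using I finite_subset by blast
  have "(\<Prod>i<n. f i (l i)) = exp ((\<Sum>i\<in>I. c i * (1 - 2 * l i)) - (\<Sum>i\<in>I. (c i)\<^sup>2) / 2)" for l
  proof -
    have "(\<Prod>i<n. f i (l i)) = (\<Prod>i\<in>I. f i (l i))"
      using I by (intro prod.mono_neutral_right) (auto simp: f_def)
    also have "\<dots> = exp (\<Sum>i\<in>I. c i * (1 - 2 * l i) - (c i)\<^sup>2 / 2)"
      by (simp add: f_def exp_sum[OF fI])
    finally show ?thesis by (simp add: sum_subtractf sum_divide_distrib)
  qed
  hence "E (coin_losses n A) (\<lambda>l. exp ((\<Sum>i\<in>I. c i * (1 - 2 * l i)) - (\<Sum>i\<in>I. (c i)\<^sup>2) / 2))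
      = E (coin_losses n A) (\<lambda>l. \<Prod>i<n. f i (l i))" by simp
  also have "\<dots> = (\<Prod>i<n. E (map_pmf of_bool (bernoulli_pmf (if i \<in> A then 1 / 4 else 1 / 2))) (f i))"
    unfolding coin_losses_def
    by (rule expectation_prod_Pi_pmf) (auto simp: f_def intro!: integrable_measure_pmf_finite)
  also have "\<dots> \<le> (\<Prod>i<n. 1)"
  proof (rule prod_mono, safe)
    fix i
    let ?e = "E (map_pmf of_bool (bernoulli_pmf (if i \<in> A then 1 / 4 else 1 / 2))) (f i)"
    show "0 \<le> ?e" by (simp add: f_def)
    show "?e \<le> 1"
    proof (cases "i \<in> I")
      case True
      hence "i \<notin> A" using I by blast
      have f1: "f i 1 = exp (- c i) * exp (- ((c i)\<^sup>2 / 2))"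
        using True by (simp add: f_def flip: exp_add)
      have f0: "f i 0 = exp (c i) * exp (- ((c i)\<^sup>2 / 2))"
        using True by (simp add: f_def flip: exp_add)
      from \<open>i \<notin> A\<close> have "?e = (exp (c i) + exp (- c i)) / 2 * exp (- ((c i)\<^sup>2 / 2))"
        by (simp add: f1 f0 field_simps)
      also have "\<dots> \<le> exp ((c i)\<^sup>2 / 2) * exp (- ((c i)\<^sup>2 / 2))"
        by (intro mult_right_mono exp_average_le) auto
      finally show ?thesis by (simp flip: exp_add)
    qed (simp add: f_def)
  qed
  finally show ?thesis by simp
qed

text \<open>\<open>R t\<close> contains the possible states after day \<open>t\<close>. It stands in
  for \<open>memory_states\<close>, which has no bound on the length of a list. Closure under
  updates is asked only for 0/1 losses, the only ones the adversary will use.\<close>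

locale learner =
  fixes n T :: nat and q N :: real and alg :: experts_algorithm and R :: "nat \<Rightarrow> memory set"
  assumes q: "0 \<le> q" "q \<le> 1"
    and N: "1 \<le> N"
    and R_finite: "\<And>t. t \<le> T \<Longrightarrow> finite (R t)"
    and R_card: "\<And>t. t \<le> T \<Longrightarrow> real (card (R t)) \<le> N"
    and R_init: "set_pmf (init alg) \<subseteq> R 0"
    and R_pick: "\<And>t m. m \<in> R t \<Longrightarrow> set_pmf (pick alg (Suc t) m) \<subseteq> {..<n}"
    and R_update: "\<And>t m j l. m \<in> R t \<Longrightarrow> j \<in> set_pmf (pick alg (Suc t) m) \<Longrightarrow> l \<in> bit_vectors n \<Longrightarrow>
      set_pmf (update alg (Suc t) m j l) \<subseteq> R (Suc t)"
begin

lemma finite_pick: "m \<in> R t \<Longrightarrow> finite (set_pmf (pick alg (Suc t) m))"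
  by (rule finite_subset[OF R_pick]) auto

lemma finite_update:
  "Suc t \<le> T \<Longrightarrow> m \<in> R t \<Longrightarrow> j \<in> set_pmf (pick alg (Suc t) m) \<Longrightarrow> l \<in> bit_vectors n \<Longrightarrow>
    finite (set_pmf (update alg (Suc t) m j l))"
  by (rule finite_subset[OF R_update R_finite])

text \<open>
  The probability that expert \<open>i\<close> is played within the next \<open>k\<close> days (or is already in \<open>P\<close>), when the
  experts in \<open>Y\<close> that have not been played yet are good.\<close>

primrec hit :: "nat set \<Rightarrow> nat \<Rightarrow> nat \<Rightarrow> nat \<Rightarrow> memory \<Rightarrow> nat set \<Rightarrow> real" where
  "hit Y i 0 t m P = of_bool (i \<in> P)"
| "hit Y i (Suc k) t m P =
     E (pick alg (Suc t) m) (\<lambda>j. E (day_losses n q (Y - P))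
       (\<lambda>l. E (update alg (Suc t) m j l) (\<lambda>m'. hit Y i k (Suc t) m' (insert j P))))"

lemma hit_bounds:
  "t + k \<le> T \<Longrightarrow> m \<in> R t \<Longrightarrow> 0 \<le> hit Y i k t m P \<and> hit Y i k t m P \<le> 1"
proof (induction k arbitrary: t m P)
  case (Suc k)
  have "0 \<le> hit Y i k (Suc t) m' (insert j P) \<and> hit Y i k (Suc t) m' (insert j P) \<le> 1"
    if "j \<in> set_pmf (pick alg (Suc t) m)" "l \<in> set_pmf (day_losses n q (Y - P))"
      "m' \<in> set_pmf (update alg (Suc t) m j l)" for j l m'
  proof (rule Suc.IH)
    show "Suc t + k \<le> T" using Suc.prems by simp
    have "l \<in> bit_vectors n" using that(2) set_day_losses by blast
    thus "m' \<in> R (Suc t)" using R_update[OF Suc.prems(2) that(1)] that(3) by blast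
  qed
  moreover have "finite (set_pmf (update alg (Suc t) m j l))"
    if "j \<in> set_pmf (pick alg (Suc t) m)" "l \<in> set_pmf (day_losses n q (Y - P))" for j l
    using Suc.prems that subsetD[OF set_day_losses] by (intro finite_update) auto
  ultimately show ?case using finite_pick[OF Suc.prems(2)]
    by (auto intro!: E_ge_const E_le_const)
qed auto

text \<open>
  Activating \<open>i\<close> tilts one coin on each day with non-zero losses, which raises the total of \<open>bend\<close> by at
  most \<open>4/3 * ln N\<close>; so the bound holds at every state, and no unplanted process has to be tracked.\<close>

lemma sum_bend_hit_le:
  "t + k \<le> T \<Longrightarrow> m \<in> R t \<Longrightarrow> finite P \<Longrightarrow>
    (\<Sum>i<n. bend (hit (insert i Y) i k t m P)) \<le> 3/2 * (real (card P) + real k) + real k * (q * (4/3 * ln N))"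
proof (induction k arbitrary: t m P)
  case 0
  \<comment> \<open>\<open>bend 1 = 3/2\<close> is the price of an expert already played; every
    further day can add one such expert to \<open>P\<close>.\<close>
  have "(\<Sum>i<n. bend (hit (insert i Y) i 0 t m P)) = (\<Sum>i<n. 3/2 * of_bool (i \<in> P))"
    by (intro sum.cong refl) (simp add: bend_def)
  also have "\<dots> = 3/2 * real (card ({..<n} \<inter> P))"
    by (simp only: sum_distrib_left[symmetric]) simp
  also have "card ({..<n} \<inter> P) \<le> card P"
    using 0 by (intro card_mono) auto
  finally show ?case by simp
next
  case (Suc k)
  let ?b = "3/2 * (real (card P) + 1 + real k) + real k * (q * (4/3 * ln N))"
  let ?z = "\<lambda>i\<in>{..<n}. 0 :: real"
  let ?J = "pick alg (Suc t) m"
  define v where "v j i m' = hit (insert i Y) i k (Suc t) m' (insert j P)" for j i m'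
  define U where "U j l = update alg (Suc t) m j l" for j l
  have t: "Suc t \<le> T" using Suc.prems by simp
  have J: "finite (set_pmf ?J)" by (rule finite_pick[OF Suc.prems(2)])
  have U: "set_pmf (U j l) \<subseteq> R (Suc t)" if "j \<in> set_pmf ?J" "l \<in> bit_vectors n" for j l
    unfolding U_def by (rule R_update[OF Suc.prems(2) that])
  have finU: "finite (set_pmf (U j l))" if "j \<in> set_pmf ?J" "l \<in> bit_vectors n" for j l
    by (rule finite_subset[OF U[OF that] R_finite[OF t]])
  have v01: "0 \<le> v j i m' \<and> v j i m' \<le> 1" if "m' \<in> R (Suc t)" for j i m'
    unfolding v_def by (rule hit_bounds) (use Suc.prems that in auto)
  have IH: "(\<Sum>i<n. bend (v j i m')) \<le> ?b" if "m' \<in> R (Suc t)" for j m'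
  proof -
    have "(\<Sum>i<n. bend (v j i m'))
        \<le> 3/2 * (real (card (insert j P)) + real k) + real k * (q * (4/3 * ln N))"
      unfolding v_def by (rule Suc.IH) (use Suc.prems that in auto)
    also have "\<dots> \<le> ?b" using card_insert_le_m1[of "card P + 1" P j] by simp
    finally show ?thesis .
  qed
  define A where "A = Y - P"
  have coin: "(\<Sum>i<n. bend (E (coin_losses n (insert i Y - P)) (\<lambda>l. E (U j l) (v j i)))) \<le> ?b + 4/3 * ln N"
    if j: "j \<in> set_pmf ?J" for j
  proof -
    \<comment> \<open>Planting \<open>i\<close> changes today's losses only if \<open>i\<close> is
      neither good nor already played, that is for \<open>i\<close> in \<open>I\<close>. On
      \<open>J\<close> the law stays that of \<open>A\<close>, and Jensen's inequality
      suffices.\<close>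
    define I where "I = {..<n} - (Y \<union> P)"
    define J where "J = {..<n} \<inter> (Y \<union> P)"
    let ?p = "coin_losses n A"
    have split: "(\<Sum>i<n. f i) = (\<Sum>i\<in>I. f i) + (\<Sum>i\<in>J. f i)" for f :: "nat \<Rightarrow> real"
    proof -
      have "{..<n} = I \<union> J" "I \<inter> J = {}" "finite I" "finite J" by (auto simp: I_def J_def)
      thus ?thesis by (metis sum.union_disjoint)
    qed
    have "(\<Sum>i\<in>I. bend (E (coin_losses n (insert i Y - P)) (\<lambda>l. E (U j l) (v j i))))
        = (\<Sum>i\<in>I. bend (E ?p (\<lambda>l. (1 + (1 - 2 * l i) / 2) * E (U j l) (v j i))))"
    proof (rule sum.cong[OF refl])
      fix i assume "i \<in> I"
      hence i: "i < n" "i \<notin> A" "insert i Y - P = insert i A" by (auto simp: I_def A_def)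
      show "bend (E (coin_losses n (insert i Y - P)) (\<lambda>l. E (U j l) (v j i)))
          = bend (E ?p (\<lambda>l. (1 + (1 - 2 * l i) / 2) * E (U j l) (v j i)))"
        unfolding i(3) by (subst E_coin_losses_tilt[OF i(1,2)]) (rule refl)
    qed
    also have "\<dots> \<le> (\<Sum>i\<in>I. E ?p (\<lambda>l. E (U j l) (\<lambda>m'. bend (v j i m')))) + 4/3 * ln N"
    proof (rule sum_bend_tilt[where M = "R (Suc t)"])
      show "finite (R (Suc t))" "real (card (R (Suc t))) \<le> N" "1 \<le> N"
        using R_finite[OF t] R_card[OF t] N by auto
      show "set_pmf (U j l) \<subseteq> R (Suc t)" if "l \<in> set_pmf ?p" for l
        using U[OF j] that set_coin_losses by blast
      show "\<bar>1 - 2 * l i\<bar> \<le> 1" if "i \<in> I" "l \<in> set_pmf ?p" for i l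
        using bit_vectors_cases[of l n i] that set_coin_losses by (fastforce simp: I_def)
      show "E ?p (\<lambda>l. 1 - 2 * l i) = 0" if "i \<in> I" for i
        using that E_coin_losses_component[of i n A "\<lambda>x. 1 - 2 * x"] by (auto simp: I_def A_def)
      show "E ?p (\<lambda>l. exp ((\<Sum>i\<in>I. c i * (1 - 2 * l i)) - (\<Sum>i\<in>I. (c i)\<^sup>2) / 2)) \<le> 1" for c
        by (rule coin_losses_subgaussian) (auto simp: I_def A_def)
      show "0 \<le> v j i m' \<and> v j i m' \<le> 1" if "m' \<in> R (Suc t)" for i m'
        by (rule v01[OF that])
    qed simp
    finally have I_le: "(\<Sum>i\<in>I. bend (E (coin_losses n (insert i Y - P)) (\<lambda>l. E (U j l) (v j i))))
        \<le> (\<Sum>i\<in>I. E ?p (\<lambda>l. E (U j l) (\<lambda>m'. bend (v j i m')))) + 4/3 * ln N" .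
    have J_le: "(\<Sum>i\<in>J. bend (E (coin_losses n (insert i Y - P)) (\<lambda>l. E (U j l) (v j i))))
        \<le> (\<Sum>i\<in>J. E ?p (\<lambda>l. E (U j l) (\<lambda>m'. bend (v j i m'))))"
    proof (rule sum_mono)
      fix i assume "i \<in> J"
      hence "insert i Y - P = A" by (auto simp: J_def A_def)
      hence "bend (E (coin_losses n (insert i Y - P)) (\<lambda>l. E (U j l) (v j i)))
          \<le> E ?p (\<lambda>l. bend (E (U j l) (v j i)))"
        by (simp add: E_bend_ge)
      also have "\<dots> \<le> E ?p (\<lambda>l. E (U j l) (\<lambda>m'. bend (v j i m')))"
        using set_coin_losses by (intro E_mono E_bend_ge finU[OF j]) auto
      finally show "bend (E (coin_losses n (insert i Y - P)) (\<lambda>l. E (U j l) (v j i)))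
          \<le> E ?p (\<lambda>l. E (U j l) (\<lambda>m'. bend (v j i m')))" .
    qed
    have "(\<Sum>i<n. bend (E (coin_losses n (insert i Y - P)) (\<lambda>l. E (U j l) (v j i))))
        \<le> (\<Sum>i<n. E ?p (\<lambda>l. E (U j l) (\<lambda>m'. bend (v j i m')))) + 4/3 * ln N"
      using I_le J_le by (simp add: split)
    also have "(\<Sum>i<n. E ?p (\<lambda>l. E (U j l) (\<lambda>m'. bend (v j i m'))))
        = E ?p (\<lambda>l. \<Sum>i<n. E (U j l) (\<lambda>m'. bend (v j i m')))"
      by (simp add: E_sum)
    also have "\<dots> \<le> ?b"
    proof (rule E_le_const)
      fix l assume "l \<in> set_pmf ?p"
      hence l: "l \<in> bit_vectors n" using set_coin_losses by blast
      have "(\<Sum>i<n. E (U j l) (\<lambda>m'. bend (v j i m'))) = E (U j l) (\<lambda>m'. \<Sum>i<n. bend (v j i m'))"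
        by (simp add: E_sum[OF finU[OF j l]])
      also have "\<dots> \<le> ?b"
        by (rule E_le_const[OF finU[OF j l]]) (use U[OF j l] IH in blast)
      finally show "(\<Sum>i<n. E (U j l) (\<lambda>m'. bend (v j i m'))) \<le> ?b" .
    qed simp
    finally show ?thesis by simp
  qed
  have zero: "(\<Sum>i<n. bend (E (U j ?z) (v j i))) \<le> ?b" if j: "j \<in> set_pmf ?J" for j
  proof -
    note z = finU[OF j zero_in_bit_vectors]
    have "(\<Sum>i<n. bend (E (U j ?z) (v j i))) \<le> (\<Sum>i<n. E (U j ?z) (\<lambda>m'. bend (v j i m')))"
      by (intro sum_mono E_bend_ge z)
    also have "\<dots> = E (U j ?z) (\<lambda>m'. \<Sum>i<n. bend (v j i m'))" by (simp add: E_sum[OF z])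
    also have "\<dots> \<le> ?b"
      by (rule E_le_const[OF z]) (use U[OF j zero_in_bit_vectors] IH in blast)
    finally show ?thesis .
  qed
  have "(\<Sum>i<n. bend (hit (insert i Y) i (Suc k) t m P))
      = (\<Sum>i<n. bend (E ?J (\<lambda>j. q * E (coin_losses n (insert i Y - P)) (\<lambda>l. E (U j l) (v j i))
          + (1 - q) * E (U j ?z) (v j i))))"
    by (simp add: v_def[abs_def] U_def E_day_losses[OF q])
  \<comment> \<open>Convexity moves \<open>bend\<close> inside the choice of the expert and the coin
    for a zero day, so the cost of the tilt is incurred only with probability
    \<open>q\<close>.\<close>
  also have "\<dots> \<le> (\<Sum>i<n. E ?J (\<lambda>j. q * bend (E (coin_losses n (insert i Y - P)) (\<lambda>l. E (U j l) (v j i)))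
          + (1 - q) * bend (E (U j ?z) (v j i))))"
    by (intro sum_mono order.trans[OF E_bend_ge[OF J]] E_mono[OF J] bend_convex q)
  also have "\<dots> = E ?J (\<lambda>j. q * (\<Sum>i<n. bend (E (coin_losses n (insert i Y - P)) (\<lambda>l. E (U j l) (v j i))))
          + (1 - q) * (\<Sum>i<n. bend (E (U j ?z) (v j i))))"
    by (simp add: E_sum[OF J, symmetric] sum.distrib sum_distrib_left)
  also have "\<dots> \<le> q * (?b + 4/3 * ln N) + (1 - q) * ?b"
    by (intro E_le_const[OF J] add_mono mult_left_mono coin zero) (use q in auto)
  also have "\<dots> = ?b + q * (4/3 * ln N)" by algebra
  also have "\<dots> = 3/2 * (real (card P) + real (Suc k)) + real (Suc k) * (q * (4/3 * ln N))"
    by (simp add: algebra_simps)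
  finally show ?case .
qed

lemma sum_hit_le:
  assumes "t + k \<le> T" "m \<in> R t"
  shows "(\<Sum>i<n. hit (insert i Y) i k t m {}) \<le> real k * (3/2 + q * (4/3 * ln N))"
proof -
  have "(\<Sum>i<n. hit (insert i Y) i k t m {}) \<le> (\<Sum>i<n. bend (hit (insert i Y) i k t m {}))"
    by (intro sum_mono bend_ge)
  also have "\<dots> \<le> real k * (3/2 + q * (4/3 * ln N))"
    using sum_bend_hit_le[OF assms, of "{}" Y] by (simp add: algebra_simps)
  finally show ?thesis .
qed

end

section \<open>Random good experts and decoys\<close>

lemma E_swap:
  assumes "finite (set_pmf p)" "finite (set_pmf q)"
  shows "E p (\<lambda>x. E q (\<lambda>y. f x y)) = E q (\<lambda>y. E p (\<lambda>x. f x y))"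
proof -
  have "E p (\<lambda>x. E q (\<lambda>y. f x y)) = (\<Sum>x\<in>set_pmf p. \<Sum>y\<in>set_pmf q. pmf p x * (pmf q y * f x y))"
    by (simp add: E_finite[OF assms(1) subset_refl] E_finite[OF assms(2) subset_refl] sum_distrib_left)
  also have "\<dots> = (\<Sum>y\<in>set_pmf q. \<Sum>x\<in>set_pmf p. pmf q y * (pmf p x * f x y))"
    by (subst sum.swap) (simp add: mult.left_commute)
  also have "\<dots> = E q (\<lambda>y. E p (\<lambda>x. f x y))"
    by (simp add: E_finite[OF assms(1) subset_refl] E_finite[OF assms(2) subset_refl] sum_distrib_left)
  finally show ?thesis .
qed

definition random_bits :: "'c set \<Rightarrow> real \<Rightarrow> ('c \<Rightarrow> bool) pmf" where
  "random_bits I p = Pi_pmf I False (\<lambda>_. bernoulli_pmf p)"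

lemma finite_random_bits [simp]:
  assumes "finite I"
  shows "finite (set_pmf (random_bits I p))"
  unfolding random_bits_def using assms
  by (intro finite_subset[OF set_Pi_pmf_subset'[OF assms]] finite_PiE_dflt) auto

text \<open>Bit \<open>c\<close> is independent of the others, and \<open>f\<close> no longer sees
  it once it has been overwritten.\<close>

lemma E_random_bits_coordinate:
  assumes I: "finite I" "c \<in> I" and p: "0 \<le> p" "p \<le> 1"
  shows "E (random_bits I p) (\<lambda>\<theta>. of_bool (\<theta> c) * f \<theta>) = p * E (random_bits I p) (\<lambda>\<theta>. f (\<theta>(c := True)))"
proof -
  let ?J = "I - {c}"
  have J: "finite ?J" "c \<notin> ?J" "insert c ?J = I" using I by auto
  have "random_bits I p = bernoulli_pmf p \<bind> (\<lambda>y. random_bits ?J p \<bind> (\<lambda>\<theta>. return_pmf (\<theta>(c := y))))"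
    unfolding random_bits_def using Pi_pmf_insert'[OF J(1,2), of False "\<lambda>_. bernoulli_pmf p"] J(3)
    by simp
  hence *: "E (random_bits I p) g
      = p * E (random_bits ?J p) (\<lambda>\<theta>. g (\<theta>(c := True))) + (1 - p) * E (random_bits ?J p) (\<lambda>\<theta>. g (\<theta>(c := False)))" for g
    using p J(1) by (simp add: E_bind mult.commute)
  show ?thesis unfolding * by (simp add: algebra_simps)
qed

lemma E_random_bits_bit:
  assumes "finite I" "c \<in> I" "0 \<le> p" "p \<le> 1"
  shows "E (random_bits I p) (\<lambda>\<theta>. of_bool (\<theta> c)) = p"
  using E_random_bits_coordinate[OF assms, of "\<lambda>_. 1"] by simp

definition row :: "nat \<Rightarrow> (nat \<times> nat \<Rightarrow> bool) \<Rightarrow> nat \<Rightarrow> nat set" where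
  "row n \<theta> r = {i. i < n \<and> \<theta> (r, i)}"

lemma finite_row [simp]: "finite (row n \<theta> r)"
  unfolding row_def by auto

lemma sum_row: "(\<Sum>i\<in>row n \<theta> r. f i) = (\<Sum>i<n. of_bool (\<theta> (r, i)) * f i)" for f :: "nat \<Rightarrow> real"
proof -
  have "(\<Sum>i<n. of_bool (\<theta> (r, i)) * f i) = (\<Sum>i\<in>{..<n} \<inter> {i. \<theta> (r, i)}. f i)"
    by (simp add: sum.inter_restrict of_bool_def mult_if_delta if_distrib[of "\<lambda>x. x * _"] cong: if_cong)
  also have "{..<n} \<inter> {i. \<theta> (r, i)} = row n \<theta> r" by (auto simp: row_def)
  finally show ?thesis by simp
qed

lemma E_card_row_Un:
  assumes "finite A" "r \<in> A" "r' \<in> A" "0 \<le> p" "p \<le> 1"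
  shows "E (random_bits (A \<times> {..<n}) p) (\<lambda>\<theta>. real (card (row n \<theta> r \<union> row n \<theta> r'))) \<le> 2 * (p * real n)"
proof -
  have fin: "finite (A \<times> {..<n})" using assms by simp
  have "E (random_bits (A \<times> {..<n}) p) (\<lambda>\<theta>. real (card (row n \<theta> r \<union> row n \<theta> r')))
      \<le> E (random_bits (A \<times> {..<n}) p) (\<lambda>\<theta>. \<Sum>i<n. of_bool (\<theta> (r, i)) + of_bool (\<theta> (r', i)))"
  proof (rule E_mono[OF finite_random_bits[OF fin]])
    fix \<theta>
    have "card (row n \<theta> r \<union> row n \<theta> r') \<le> card (row n \<theta> r) + card (row n \<theta> r')" by (rule card_Un_le)
    moreover have "real (card (row n \<theta> s)) = (\<Sum>i<n. of_bool (\<theta> (s, i)))" for s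
      using sum_row[of "\<lambda>_. 1" n \<theta> s] by simp
    ultimately show "real (card (row n \<theta> r \<union> row n \<theta> r')) \<le> (\<Sum>i<n. of_bool (\<theta> (r, i)) + of_bool (\<theta> (r', i)))"
      by (simp only: sum.distrib flip: of_nat_add) (metis of_nat_add of_nat_le_iff)
  qed
  also have "\<dots> = (\<Sum>i<n. p + p)"
    unfolding E_sum[OF finite_random_bits[OF fin]]
    by (rule sum.cong[OF refl]) (simp add: E_add[OF finite_random_bits[OF fin]] E_random_bits_bit[OF fin] assms)
  finally show ?thesis by (simp add: algebra_simps)
qed

text \<open>Exchangeability column by column: \<open>\<pi>\<close> swaps rows \<open>r\<close> and
  \<open>r'\<close> in the columns selected by \<open>\<sigma>\<close>, a bijection of the index set
  under which identically distributed bits keep their law.\<close>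

lemma random_bits_swap:
  fixes \<sigma> :: "nat \<Rightarrow> bool"
  assumes A: "finite A" "r \<in> A" "r' \<in> A"
  defines "\<pi> \<equiv> \<lambda>(a, i). (if \<sigma> i then Transposition.transpose r r' a else a, i)"
  shows "random_bits (A \<times> {..<n::nat}) p = map_pmf (\<lambda>\<theta>. \<theta> \<circ> \<pi>) (random_bits (A \<times> {..<n}) p)"
  unfolding random_bits_def
proof (rule Pi_pmf_bij_betw)
  have inv: "\<pi> (\<pi> x) = x" for x by (auto simp: \<pi>_def split: prod.splits if_splits)
  have mem: "\<pi> x \<in> A \<times> {..<n} \<longleftrightarrow> x \<in> A \<times> {..<n}" for x
    using A by (auto simp: \<pi>_def Transposition.transpose_def split: prod.splits if_splits)
  have img: "\<pi> ` (A \<times> {..<n}) \<subseteq> A \<times> {..<n}" using mem by blast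
  show "bij_betw \<pi> (A \<times> {..<n}) (A \<times> {..<n})"
    by (rule bij_betw_byWitness[OF _ _ img img]) (rule ballI, rule inv)+
  show "\<pi> x \<notin> A \<times> {..<n}" if "x \<notin> A \<times> {..<n}" for x
    using that unfolding mem .
qed (use A in auto)

text \<open>Symmetrisation: swapping the two rows in a random set of columns preserves the law and
  the union \<open>Y\<close>, hence also \<open>h\<close>, which sees only the union. Given
  \<open>\<theta>\<close>, the summands become independent signed terms, and only the columns in
  \<open>Y\<close> contribute, so a correction by the size of \<open>Y\<close> suffices.\<close>

lemma random_bits_rows_subgaussian:
  fixes h :: "nat set \<Rightarrow> nat \<Rightarrow> real" and n :: nat
  assumes A: "finite A" "r \<in> A" "r' \<in> A"
    and h: "\<And>Y i. 0 \<le> h Y i \<and> h Y i \<le> 1"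
  defines "Y \<equiv> \<lambda>\<theta>. row n \<theta> r \<union> row n \<theta> r'"
  shows "E (random_bits (A \<times> {..<n}) p) (\<lambda>\<theta>.
      exp (s * (\<Sum>i<n. h (Y \<theta>) i * (of_bool (\<theta> (r, i)) - of_bool (\<theta> (r', i)))) - s\<^sup>2 / 2 * real (card (Y \<theta>)))) \<le> 1"
    (is "E ?B ?\<Phi> \<le> 1")
proof -
  define S where "S = Pi_pmf {..<n} False (\<lambda>_. bernoulli_pmf (1 / 2))"
  define \<pi> :: "(nat \<Rightarrow> bool) \<Rightarrow> nat \<times> nat \<Rightarrow> nat \<times> nat"
    where "\<pi> \<sigma> = (\<lambda>(a, i). (if \<sigma> i then Transposition.transpose r r' a else a, i))" for \<sigma>
  define x where "x \<theta> i = s * h (Y \<theta>) i * (of_bool (\<theta> (r, i)) - of_bool (\<theta> (r', i)))" for \<theta> i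
  define w where "w \<theta> i = s\<^sup>2 / 2 * of_bool (i \<in> Y \<theta>)" for \<theta> i
  have finB: "finite (set_pmf ?B)" using A by simp
  have finS: "finite (set_pmf S)"
    unfolding S_def random_bits_def[symmetric] by simp
  have Phi: "?\<Phi> (\<theta> \<circ> \<pi> \<sigma>) = (\<Prod>i<n. exp ((if \<sigma> i then - x \<theta> i else x \<theta> i) - w \<theta> i))" for \<theta> \<sigma>
  proof -
    have Y: "Y (\<theta> \<circ> \<pi> \<sigma>) = Y \<theta>"
      by (auto simp: Y_def row_def \<pi>_def)
    have "s * (\<Sum>i<n. h (Y \<theta>) i * (of_bool ((\<theta> \<circ> \<pi> \<sigma>) (r, i)) - of_bool ((\<theta> \<circ> \<pi> \<sigma>) (r', i))))
        = (\<Sum>i<n. if \<sigma> i then - x \<theta> i else x \<theta> i)"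
      unfolding sum_distrib_left
      by (intro sum.cong refl) (auto simp: x_def \<pi>_def)
    moreover have "s\<^sup>2 / 2 * real (card (Y \<theta>)) = (\<Sum>i<n. w \<theta> i)"
    proof -
      have "{..<n} \<inter> Y \<theta> = Y \<theta>" by (auto simp: Y_def row_def)
      thus ?thesis unfolding w_def sum_distrib_left[symmetric] by simp
    qed
    ultimately show ?thesis unfolding Y by (simp add: sum_subtractf flip: exp_sum)
  qed
  have swap: "E ?B (\<lambda>\<theta>. ?\<Phi> (\<theta> \<circ> \<pi> \<sigma>)) = E ?B ?\<Phi>" for \<sigma>
    by (subst (2) random_bits_swap[OF A, of n p \<sigma>]) (simp add: \<pi>_def)
  have "E ?B ?\<Phi> = E S (\<lambda>\<sigma>. E ?B (\<lambda>\<theta>. ?\<Phi> (\<theta> \<circ> \<pi> \<sigma>)))"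
    by (simp only: swap) simp
  also have "\<dots> = E ?B (\<lambda>\<theta>. E S (\<lambda>\<sigma>. ?\<Phi> (\<theta> \<circ> \<pi> \<sigma>)))"
    by (rule E_swap[OF finS finB])
  also have "\<dots> \<le> 1"
  proof (rule E_le_const[OF finB])
    fix \<theta>
    have "E S (\<lambda>\<sigma>. ?\<Phi> (\<theta> \<circ> \<pi> \<sigma>))
        = E S (\<lambda>\<sigma>. \<Prod>i<n. (\<lambda>i c. exp ((if c then - x \<theta> i else x \<theta> i) - w \<theta> i)) i (\<sigma> i))"
      by (simp only: Phi)
    also have "\<dots> = (\<Prod>i<n. E (bernoulli_pmf (1 / 2)) (\<lambda>c. exp ((if c then - x \<theta> i else x \<theta> i) - w \<theta> i)))"
      unfolding S_def by (rule expectation_prod_Pi_pmf) (auto intro!: integrable_measure_pmf_finite)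
    also have "\<dots> \<le> (\<Prod>i<n. 1)"
    proof (intro prod_mono conjI)
      fix i
      have "(x \<theta> i)\<^sup>2 / 2 \<le> w \<theta> i" if "i < n"
      proof -
        have "(h (Y \<theta>) i)\<^sup>2 \<le> 1" using h by (simp add: abs_square_le_1)
        hence "s\<^sup>2 * (h (Y \<theta>) i)\<^sup>2 \<le> s\<^sup>2" by (simp add: mult_left_le)
        thus ?thesis using that
          by (auto simp: x_def w_def Y_def row_def power_mult_distrib)
      qed
      moreover assume "i \<in> {..<n}"
      ultimately have xw: "(x \<theta> i)\<^sup>2 / 2 \<le> w \<theta> i" by simp
      have "E (bernoulli_pmf (1 / 2)) (\<lambda>c. exp ((if c then - x \<theta> i else x \<theta> i) - w \<theta> i))
          = (exp (x \<theta> i) + exp (- x \<theta> i)) / 2 * exp (- w \<theta> i)"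
        by (simp add: exp_diff exp_minus field_simps)
      also have "\<dots> \<le> exp ((x \<theta> i)\<^sup>2 / 2) * exp (- w \<theta> i)"
        by (intro mult_right_mono exp_average_le) auto
      also have "\<dots> \<le> 1" using xw by (simp flip: exp_add)
      finally show "E (bernoulli_pmf (1 / 2)) (\<lambda>c. exp ((if c then - x \<theta> i else x \<theta> i) - w \<theta> i)) \<le> 1" .
    qed simp
    finally show "E S (\<lambda>\<sigma>. ?\<Phi> (\<theta> \<circ> \<pi> \<sigma>)) \<le> 1" by simp
  qed
  finally show ?thesis .
qed

text \<open>The state \<open>m\<close> may depend on both rows, but having at most \<open>N\<close>
  values it favours one of them by little. The parameter \<open>s\<close> is the exponent of the
  Chernoff argument, left open to be balanced later.\<close>

lemma rows_indistinguishable: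
  fixes h :: "'m \<Rightarrow> nat set \<Rightarrow> nat \<Rightarrow> real" and n :: nat
  assumes A: "finite A" "r \<in> A" "r' \<in> A" and p: "0 \<le> p" "p \<le> 1" and "0 < s"
    and M: "finite M" "real (card M) \<le> N" "1 \<le> N"
    and \<nu>: "\<And>\<theta>. set_pmf (\<nu> \<theta>) \<subseteq> M"
    and h: "\<And>m Y i. m \<in> M \<Longrightarrow> 0 \<le> h m Y i \<and> h m Y i \<le> 1"
  defines "Y \<equiv> \<lambda>\<theta>. row n \<theta> r \<union> row n \<theta> r'"
  shows "E (random_bits (A \<times> {..<n}) p) (\<lambda>\<theta>. E (\<nu> \<theta>) (\<lambda>m.
      (\<Sum>i\<in>row n \<theta> r. h m (Y \<theta>) i) - (\<Sum>i\<in>row n \<theta> r'. h m (Y \<theta>) i))) \<le> ln N / s + s * (p * real n)"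
proof -
  let ?B = "random_bits (A \<times> {..<n}) p"
  have finB: "finite (set_pmf ?B)" using A by simp
  have fin\<nu>: "finite (set_pmf (\<nu> \<theta>))" for \<theta> by (rule finite_subset[OF \<nu> M(1)])
  define D where "D m \<theta> = (\<Sum>i\<in>row n \<theta> r. h m (Y \<theta>) i) - (\<Sum>i\<in>row n \<theta> r'. h m (Y \<theta>) i)" for m \<theta>
  have D_eq: "D m \<theta> = (\<Sum>i<n. h m (Y \<theta>) i * (of_bool (\<theta> (r, i)) - of_bool (\<theta> (r', i))))" for m \<theta>
    by (simp add: D_def sum_row algebra_simps sum_subtractf)
  have "E ?B (\<lambda>\<theta>. E (\<nu> \<theta>) (\<lambda>m. s * D m \<theta> - s\<^sup>2 / 2 * real (card (Y \<theta>)))) \<le> ln N"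
  proof (rule expectation_maximal[OF finB M \<nu>])
    show "E ?B (\<lambda>\<theta>. exp (s * D m \<theta> - s\<^sup>2 / 2 * real (card (Y \<theta>)))) \<le> 1" if "m \<in> M" for m
      unfolding D_eq Y_def by (rule random_bits_rows_subgaussian[OF A h[OF that]])
  qed
  also have "E ?B (\<lambda>\<theta>. E (\<nu> \<theta>) (\<lambda>m. s * D m \<theta> - s\<^sup>2 / 2 * real (card (Y \<theta>))))
      = s * E ?B (\<lambda>\<theta>. E (\<nu> \<theta>) (\<lambda>m. D m \<theta>)) - s\<^sup>2 / 2 * E ?B (\<lambda>\<theta>. real (card (Y \<theta>)))"
    by (simp add: E_diff[OF fin\<nu>] E_diff[OF finB])
  finally have "s * E ?B (\<lambda>\<theta>. E (\<nu> \<theta>) (\<lambda>m. D m \<theta>)) \<le> ln N + s\<^sup>2 / 2 * E ?B (\<lambda>\<theta>. real (card (Y \<theta>)))"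
    by simp
  also have "\<dots> \<le> ln N + s\<^sup>2 / 2 * (2 * (p * real n))"
    unfolding Y_def by (intro add_left_mono mult_left_mono E_card_row_Un A p) auto
  also have "\<dots> = s * (ln N / s + s * (p * real n))"
    using \<open>0 < s\<close> by (simp add: field_simps power2_eq_square)
  finally show ?thesis using \<open>0 < s\<close> unfolding D_def by simp
qed

context learner
begin

text \<open>The initial state is independent of row \<open>r\<close>. Hence "\<open>i\<close>
  belongs to row \<open>r\<close>" can be replaced by planting \<open>i\<close> at the price of a
  factor \<open>p\<close>, and \<open>sum_hit_le\<close> bounds the sum over all plants at each
  fixed state.\<close>

lemma sum_row_hit_le:
  assumes A: "finite A" "r \<in> A" and p: "0 \<le> p" "p \<le> 1" and t: "t + k \<le> T"
    and \<nu>: "\<And>\<theta>. set_pmf (\<nu> \<theta>) \<subseteq> R t" "\<And>\<theta> i. \<nu> (\<theta>((r, i) := True)) = \<nu> \<theta>"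
    and "r \<noteq> r'"
  defines "Y \<equiv> \<lambda>\<theta>. row n \<theta> r \<union> row n \<theta> r'"
  shows "E (random_bits (A \<times> {..<n}) p) (\<lambda>\<theta>. E (\<nu> \<theta>) (\<lambda>m. \<Sum>i\<in>row n \<theta> r. hit (Y \<theta>) i k t m {}))
    \<le> p * (real k * (3/2 + q * (4/3 * ln N)))"
proof -
  let ?B = "random_bits (A \<times> {..<n}) p"
  have finB: "finite (set_pmf ?B)" using A by simp
  have fin\<nu>: "finite (set_pmf (\<nu> \<theta>))" for \<theta>
    by (rule finite_subset[OF \<nu>(1) R_finite]) (use t in simp)
  have "E ?B (\<lambda>\<theta>. E (\<nu> \<theta>) (\<lambda>m. \<Sum>i\<in>row n \<theta> r. hit (Y \<theta>) i k t m {}))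
      = (\<Sum>i<n. E ?B (\<lambda>\<theta>. of_bool (\<theta> (r, i)) * E (\<nu> \<theta>) (\<lambda>m. hit (Y \<theta>) i k t m {})))"
    by (simp only: sum_row E_sum[OF fin\<nu>] E_sum[OF finB] integral_mult_right_zero)
  also have "\<dots> = (\<Sum>i<n. p * E ?B (\<lambda>\<theta>. E (\<nu> \<theta>) (\<lambda>m. hit (insert i (Y \<theta>)) i k t m {})))"
  proof (rule sum.cong[OF refl])
    fix i assume "i \<in> {..<n}"
    hence "Y (\<theta>((r, i) := True)) = insert i (Y \<theta>)" for \<theta>
      using \<open>r \<noteq> r'\<close> by (auto simp: Y_def row_def)
    thus "E ?B (\<lambda>\<theta>. of_bool (\<theta> (r, i)) * E (\<nu> \<theta>) (\<lambda>m. hit (Y \<theta>) i k t m {}))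
        = p * E ?B (\<lambda>\<theta>. E (\<nu> \<theta>) (\<lambda>m. hit (insert i (Y \<theta>)) i k t m {}))"
      using A p \<open>i \<in> {..<n}\<close> \<nu>(2) by (subst E_random_bits_coordinate) auto
  qed
  also have "\<dots> = p * E ?B (\<lambda>\<theta>. E (\<nu> \<theta>) (\<lambda>m. \<Sum>i<n. hit (insert i (Y \<theta>)) i k t m {}))"
    by (simp add: E_sum[OF fin\<nu>] E_sum[OF finB] sum_distrib_left)
  also have "\<dots> \<le> p * (real k * (3/2 + q * (4/3 * ln N)))"
    by (intro mult_left_mono E_le_const[OF finB] E_le_const[OF fin\<nu>] sum_hit_le t p) (use \<nu>(1) in blast)
  finally show ?thesis .
qed

end

section \<open>The hiding adversary\<close>

lemma play_lengths:
  "(ms, as, ls) \<in> set_pmf (play alg adv t) \<Longrightarrow> length as = t \<and> length ls = t"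
proof (induction t arbitrary: ms as ls)
  case (Suc t)
  then obtain ms' as' ls' l i where "(ms', as', ls') \<in> set_pmf (play alg adv t)"
    "as = as' @ [i]" "ls = ls' @ [l]"
    by auto
  thus ?case using Suc.IH by auto
qed auto

lemma play_cong:
  assumes "\<And>as ls. length as < t \<Longrightarrow> adv as ls = adv' as ls"
  shows "play alg adv t = play alg adv' t"
  using assms
proof (induction t)
  case (Suc t)
  have IH: "play alg adv t = play alg adv' t" using Suc by simp
  show ?case unfolding play.simps IH
    by (intro bind_pmf_cong refl) (use play_lengths Suc.prems in \<open>fastforce split: prod.splits\<close>)
qed simp

text \<open>
  Bit \<open>\<theta> (0, i)\<close> says that \<open>i\<close> is permanently good, bit \<open>\<theta> (Suc e, i)\<close> that it is a decoy during
  the \<open>e\<close>-th epoch of \<open>B\<close> days.  An expert is inactive for the rest of an epoch once it was played.\<close>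

definition active :: "nat \<Rightarrow> nat \<Rightarrow> (nat \<times> nat \<Rightarrow> bool) \<Rightarrow> nat list \<Rightarrow> nat set" where
  "active n B \<theta> as = (let e = length as div B in
     row n \<theta> 0 \<union> row n \<theta> (Suc e) - set (drop (e * B) as))"

definition hiding_adversary :: "nat \<Rightarrow> real \<Rightarrow> nat \<Rightarrow> (nat \<times> nat \<Rightarrow> bool) \<Rightarrow> adversary" where
  "hiding_adversary n q B \<theta> as ls = day_losses n q (active n B \<theta> as)"

lemma adaptive_hiding_adversary: "adaptive_adversary n (hiding_adversary n q B \<theta>)"
  unfolding adaptive_adversary_def hiding_adversary_def
  using set_day_losses bit_vectors_subset by blast

lemma E_day_losses_component:
  assumes "0 \<le> q" "q \<le> 1" "i < n"
  shows "E (day_losses n q A) (\<lambda>l. l i) = q * (1/2 - of_bool (i \<in> A) / 4)"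
  using E_coin_losses_component[OF assms(3), of A "\<lambda>x. x"] assms
  by (simp add: E_day_losses[OF assms(1,2)])

text \<open>The best expert does at least as well as any mixture; the mixture meant is
  \<open>weight\<close>, spread over the good experts.\<close>

lemma realized_regret_ge:
  fixes w :: "nat \<Rightarrow> real"
  assumes "0 < n" "\<And>i. i < n \<Longrightarrow> 0 \<le> w i" "(\<Sum>i<n. w i) = 1"
  shows "(\<Sum>t<length ls. (ls ! t) (as ! t) - (\<Sum>i<n. w i * (ls ! t) i)) \<le> realized_regret n as ls"
proof -
  let ?L = "\<lambda>i. \<Sum>t<length ls. (ls ! t) i"
  let ?m = "MIN i\<in>{..<n}. ?L i"
  have "?m = (\<Sum>i<n. w i * ?m)" using assms(3) by (simp flip: sum_distrib_right)
  also have "\<dots> \<le> (\<Sum>i<n. w i * ?L i)"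
    by (intro sum_mono mult_left_mono Min_le assms) auto
  also have "\<dots> = (\<Sum>t<length ls. \<Sum>i<n. w i * (ls ! t) i)"
    by (subst sum.swap) (simp add: sum_distrib_left)
  finally show ?thesis by (simp add: realized_regret_def sum_subtractf)
qed

lemma sum_epochs:
  fixes x :: "nat \<Rightarrow> nat \<Rightarrow> real"
  assumes "0 < B" "\<And>e. x e 0 = 0"
  shows "(\<Sum>t<T. x (t div B) (Suc (t mod B)) - x (t div B) (t mod B))
    = (\<Sum>e<T div B. x e B) + x (T div B) (T mod B)"
proof (induction T)
  case (Suc T)
  thus ?case using assms by (auto simp: div_Suc mod_Suc)
qed (use assms in simp)

text \<open>With \<open>y = x / g\<close> this is \<open>y - y^2 / 4 <= min 1 y\<close>. A quadratic
  minorant makes the first two moments of the number of good experts sufficient.\<close>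

lemma min_ratio_ge:
  fixes x g :: real
  assumes "0 < g" "0 \<le> x"
  shows "x / g - x\<^sup>2 / (4 * g\<^sup>2) \<le> x / max g x"
proof (cases "x \<le> g")
  case True
  thus ?thesis using assms by simp
next
  case False
  have "0 \<le> (x / (2 * g) - 1)\<^sup>2" by simp
  moreover have "x / g - x\<^sup>2 / (4 * g\<^sup>2) = 1 - (x / (2 * g) - 1)\<^sup>2"
    by (simp add: power2_diff power_divide power_mult_distrib)
  ultimately have "x / g - x\<^sup>2 / (4 * g\<^sup>2) \<le> 1" by linarith
  thus ?thesis using False assms by simp
qed

lemma E_card_row_square_le:
  assumes "finite A" "r \<in> A" "0 \<le> p" "p \<le> 1"
  shows "E (random_bits (A \<times> {..<n}) p) (\<lambda>\<theta>. (real (card (row n \<theta> r)))\<^sup>2) \<le> p * real n * (1 + p * real n)"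
    and "E (random_bits (A \<times> {..<n}) p) (\<lambda>\<theta>. real (card (row n \<theta> r))) = p * real n"
proof -
  let ?B = "random_bits (A \<times> {..<n}) p"
  have fin: "finite (A \<times> {..<n})" using assms by simp
  note finB = finite_random_bits[OF fin]
  have card: "real (card (row n \<theta> r)) = (\<Sum>i<n. of_bool (\<theta> (r, i)) * 1)" for \<theta>
    using sum_row[of "\<lambda>_. 1" n \<theta> r] by simp
  show mean: "E ?B (\<lambda>\<theta>. real (card (row n \<theta> r))) = p * real n"
  proof -
    have "E ?B (\<lambda>\<theta>. real (card (row n \<theta> r))) = (\<Sum>i<n. E ?B (\<lambda>\<theta>. of_bool (\<theta> (r, i))))"
      unfolding card by (simp only: E_sum[OF finB] mult_1_right)
    also have "\<dots> = (\<Sum>i<n. p)"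
      by (intro sum.cong refl E_random_bits_bit fin) (use assms in auto)
    finally show ?thesis by simp
  qed
  have "E ?B (\<lambda>\<theta>. (real (card (row n \<theta> r)))\<^sup>2)
      = (\<Sum>i<n. E ?B (\<lambda>\<theta>. of_bool (\<theta> (r, i)) * real (card (row n \<theta> r))))"
    unfolding power2_eq_square by (subst (1) card) (simp only: sum_distrib_right E_sum[OF finB] mult_1_right)
  also have "\<dots> \<le> (\<Sum>i<n. p * (1 + p * real n))"
  proof (rule sum_mono)
    fix i assume "i \<in> {..<n}"
    hence "E ?B (\<lambda>\<theta>. of_bool (\<theta> (r, i)) * real (card (row n \<theta> r)))
        = p * E ?B (\<lambda>\<theta>. real (card (row n (\<theta>((r, i) := True)) r)))"
      by (intro E_random_bits_coordinate fin) (use assms in auto)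
    also have "\<dots> \<le> p * E ?B (\<lambda>\<theta>. 1 + real (card (row n \<theta> r)))"
    proof (intro mult_left_mono E_mono finB)
      fix \<theta>
      have "row n (\<theta>((r, i) := True)) r \<subseteq> insert i (row n \<theta> r)" by (auto simp: row_def)
      hence "card (row n (\<theta>((r, i) := True)) r) \<le> card (insert i (row n \<theta> r))"
        by (intro card_mono) auto
      also have "\<dots> \<le> Suc (card (row n \<theta> r))" by (rule card_insert_le_m1) auto
      finally show "real (card (row n (\<theta>((r, i) := True)) r)) \<le> 1 + real (card (row n \<theta> r))" by simp
    qed (use assms in auto)
    finally show "E ?B (\<lambda>\<theta>. of_bool (\<theta> (r, i)) * real (card (row n \<theta> r))) \<le> p * (1 + p * real n)"
      by (simp add: E_add[OF finB] mean)
  qed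
  finally show "E ?B (\<lambda>\<theta>. (real (card (row n \<theta> r)))\<^sup>2) \<le> p * real n * (1 + p * real n)"
    by (simp add: mult_ac)
qed

section \<open>One day of play in expectation\<close>

context learner
begin

lemma play_R:
  assumes "\<And>as ls. set_pmf (adv as ls) \<subseteq> bit_vectors n"
  shows "(ms, as, ls) \<in> set_pmf (play alg adv t) \<Longrightarrow> last ms \<in> R t"
proof (induction t arbitrary: ms as ls)
  case 0
  thus ?case using R_init by auto
next
  case (Suc t)
  then obtain ms' as' ls' l i m where *: "(ms', as', ls') \<in> set_pmf (play alg adv t)"
    "l \<in> set_pmf (adv as' ls')" "i \<in> set_pmf (pick alg (Suc t) (last ms'))"
    "m \<in> set_pmf (update alg (Suc t) (last ms') i l)" "ms = ms' @ [m]"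
    by auto
  have "l \<in> bit_vectors n" using *(2) assms by blast
  thus ?case using R_update[OF Suc.IH[OF *(1)] *(3)] *(4,5) by auto
qed

text \<open>\<open>play\<close> draws the loss before the action, \<open>hit\<close> the action
  before the loss. Both draws depend on the past alone, so the expectations may be
  exchanged.\<close>

lemma E_play_Suc:
  assumes adv: "\<And>as ls. set_pmf (adv as ls) \<subseteq> bit_vectors n" and t: "Suc t \<le> T"
    and fin: "finite (set_pmf (play alg adv t))"
  shows "finite (set_pmf (play alg adv (Suc t)))"
    and "E (play alg adv (Suc t)) (\<lambda>(ms, as, ls). g ms as ls) =
      E (play alg adv t) (\<lambda>(ms, as, ls). E (pick alg (Suc t) (last ms)) (\<lambda>i. E (adv as ls)
        (\<lambda>l. E (update alg (Suc t) (last ms) i l) (\<lambda>m. g (ms @ [m]) (as @ [i]) (ls @ [l])))))"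
proof -
  define K where "K x = (case x of (ms, as, ls) \<Rightarrow> adv as ls \<bind> (\<lambda>l. pick alg (Suc t) (last ms) \<bind>
    (\<lambda>i. update alg (Suc t) (last ms) i l \<bind> (\<lambda>m. return_pmf (ms @ [m], as @ [i], ls @ [l])))))"
    for x :: "memory list \<times> nat list \<times> loss list"
  have play: "play alg adv (Suc t) = play alg adv t \<bind> K"
    unfolding K_def by simp
  have finA: "finite (set_pmf (adv as ls))" for as ls
    by (rule finite_subset[OF adv finite_bit_vectors])
  have finP: "finite (set_pmf (pick alg (Suc t) (last ms)))"
    if "(ms, as, ls) \<in> set_pmf (play alg adv t)" for ms as ls
    by (rule finite_pick[OF play_R[OF adv that]])
  have finU: "finite (set_pmf (update alg (Suc t) (last ms) i l))"
    if "(ms, as, ls) \<in> set_pmf (play alg adv t)" "i \<in> set_pmf (pick alg (Suc t) (last ms))"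
      "l \<in> set_pmf (adv as ls)" for ms as ls i l
    by (rule finite_update[OF t play_R[OF adv that(1)] that(2)]) (use that adv in blast)
  have finK: "finite (set_pmf (K x))" if "x \<in> set_pmf (play alg adv t)" for x
    using that finA finP finU by (cases x) (auto simp: K_def)
  show "finite (set_pmf (play alg adv (Suc t)))"
    unfolding play using fin finK by simp
  have "E (K x) (\<lambda>(ms, as, ls). g ms as ls) = (case x of (ms, as, ls) \<Rightarrow>
      E (pick alg (Suc t) (last ms)) (\<lambda>i. E (adv as ls)
        (\<lambda>l. E (update alg (Suc t) (last ms) i l) (\<lambda>m. g (ms @ [m]) (as @ [i]) (ls @ [l])))))"
    if x: "x \<in> set_pmf (play alg adv t)" for x
  proof -
    obtain ms as ls where [simp]: "x = (ms, as, ls)" by (cases x)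
    note x' = x[simplified]
    let ?P = "pick alg (Suc t) (last ms)" and ?A = "adv as ls" and ?U = "update alg (Suc t) (last ms)"
    let ?r = "\<lambda>i l m. return_pmf (ms @ [m], as @ [i], ls @ [l])"
    have "E (K x) (\<lambda>(ms, as, ls). g ms as ls)
        = E ?A (\<lambda>l. E (?P \<bind> (\<lambda>i. ?U i l \<bind> ?r i l)) (\<lambda>(ms, as, ls). g ms as ls))"
      unfolding K_def \<open>x = _\<close> prod.case
      by (rule E_bind[OF finA]) (use finP[OF x'] finU[OF x'] in auto)
    also have "\<dots> = E ?A (\<lambda>l. E ?P (\<lambda>i. E (?U i l) (\<lambda>m. g (ms @ [m]) (as @ [i]) (ls @ [l]))))"
    proof (rule E_cong)
      fix l assume l: "l \<in> set_pmf ?A"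
      have "E (?P \<bind> (\<lambda>i. ?U i l \<bind> ?r i l)) (\<lambda>(ms, as, ls). g ms as ls)
          = E ?P (\<lambda>i. E (?U i l \<bind> ?r i l) (\<lambda>(ms, as, ls). g ms as ls))"
        by (rule E_bind[OF finP[OF x']]) (use finU[OF x' _ l] in auto)
      also have "\<dots> = E ?P (\<lambda>i. E (?U i l) (\<lambda>m. g (ms @ [m]) (as @ [i]) (ls @ [l])))"
        by (rule E_cong) (simp add: E_bind finU[OF x' _ l])
      finally show "E (?P \<bind> (\<lambda>i. ?U i l \<bind> ?r i l)) (\<lambda>(ms, as, ls). g ms as ls) = \<dots>" .
    qed
    also have "\<dots> = E ?P (\<lambda>i. E ?A (\<lambda>l. E (?U i l) (\<lambda>m. g (ms @ [m]) (as @ [i]) (ls @ [l]))))"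
      by (rule E_swap[OF finA finP[OF x']])
    finally show ?thesis by simp
  qed
  thus "E (play alg adv (Suc t)) (\<lambda>(ms, as, ls). g ms as ls) =
      E (play alg adv t) (\<lambda>(ms, as, ls). E (pick alg (Suc t) (last ms)) (\<lambda>i. E (adv as ls)
        (\<lambda>l. E (update alg (Suc t) (last ms) i l) (\<lambda>m. g (ms @ [m]) (as @ [i]) (ls @ [l])))))"
    unfolding play by (subst E_bind[OF fin finK]) (auto intro: E_cong)
qed

lemma finite_play:
  assumes adv: "\<And>as ls. set_pmf (adv as ls) \<subseteq> bit_vectors n"
  shows "t \<le> T \<Longrightarrow> finite (set_pmf (play alg adv t))"
proof (induction t)
  case 0
  show ?case using finite_subset[OF R_init R_finite] by simp
next
  case (Suc t)
  show ?case by (rule E_play_Suc(1)[OF adv]) (use Suc in auto)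
qed

end

text \<open>\<open>B_le\<close> compares the length of an epoch with the expected number of good
  experts: if hits per day are rare, then one epoch spoils only a small fraction of the good
  experts.\<close>

locale hiding_game = learner +
  fixes B :: nat and p :: real
  assumes B: "0 < B" and p: "0 < p" "p \<le> 1" and B_le: "real B \<le> p * real n"
begin

definition adv where "adv \<theta> = hiding_adversary n q B \<theta>"

definition targets where "targets \<theta> e = row n \<theta> 0 \<union> row n \<theta> (Suc e)"

text \<open>Rows up to \<open>Suc T\<close> suffice: an epoch \<open>e\<close> that starts by day
  \<open>T\<close> has \<open>e <= e * B <= T\<close>, and its decoys are in row
  \<open>Suc e\<close>.\<close>

definition params where "params = random_bits ({..Suc T} \<times> {..<n}) p"

lemma finite_params [simp]: "finite (set_pmf params)"
  unfolding params_def by simp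

lemma n_pos: "0 < n"
  using B B_le by (cases n) auto

lemma adv_bits: "set_pmf (adv \<theta> as ls) \<subseteq> bit_vectors n"
  unfolding adv_def hiding_adversary_def by (rule set_day_losses)

lemma finite_play_adv: "t \<le> T \<Longrightarrow> finite (set_pmf (play alg (adv \<theta>) t))"
  by (rule finite_play[OF adv_bits])

lemma play_R_adv: "(ms, as, ls) \<in> set_pmf (play alg (adv \<theta>) t) \<Longrightarrow> last ms \<in> R t"
  by (rule play_R[OF adv_bits])

lemma E_play_adv_Suc:
  assumes "Suc t \<le> T"
  shows "E (play alg (adv \<theta>) (Suc t)) (\<lambda>(ms, as, ls). g ms as ls) =
      E (play alg (adv \<theta>) t) (\<lambda>(ms, as, ls). E (pick alg (Suc t) (last ms))
        (\<lambda>i. E (day_losses n q (active n B \<theta> as))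
          (\<lambda>l. E (update alg (Suc t) (last ms) i l) (\<lambda>m. g (ms @ [m]) (as @ [i]) (ls @ [l])))))"
  using E_play_Suc(2)[of "adv \<theta>" t g, OF adv_bits assms finite_play_adv] assms
  by (simp add: adv_def hiding_adversary_def)

lemma active_epoch:
  assumes "length as = e * B + k" "k < B"
  shows "active n B \<theta> as = targets \<theta> e - set (drop (e * B) as)"
proof -
  have "length as div B = e" using assms B by simp
  thus ?thesis by (simp add: active_def targets_def)
qed

text \<open>A martingale property: within an epoch, \<open>hit\<close> evaluated at the current
  state, for the days remaining, keeps its mean along the actual play. The case
  \<open>k' = 0\<close> turns counts of played targets into values of \<open>hit\<close> at the
  start of the epoch.\<close>

lemma E_play_hit:
  assumes "e * B + k + k' \<le> T" "k \<le> B"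
  shows "E (play alg (adv \<theta>) (e * B + k))
      (\<lambda>(ms, as, ls). hit (targets \<theta> e) i k' (e * B + k) (last ms) (set (drop (e * B) as)))
    = E (play alg (adv \<theta>) (e * B)) (\<lambda>(ms, as, ls). hit (targets \<theta> e) i (k + k') (e * B) (last ms) {})"
  using assms
proof (induction k arbitrary: k')
  case 0
  show ?case unfolding add_0_right add_0_left by (rule E_cong) (auto dest: play_lengths)
next
  case (Suc k)
  let ?Y = "targets \<theta> e"
  have "E (play alg (adv \<theta>) (e * B + Suc k))
      (\<lambda>(ms, as, ls). hit ?Y i k' (e * B + Suc k) (last ms) (set (drop (e * B) as)))
    = E (play alg (adv \<theta>) (e * B + k)) (\<lambda>(ms, as, ls). E (pick alg (Suc (e * B + k)) (last ms))
        (\<lambda>j. E (day_losses n q (active n B \<theta> as))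
          (\<lambda>l. E (update alg (Suc (e * B + k)) (last ms) j l)
            (\<lambda>m. hit ?Y i k' (Suc (e * B + k)) m (set (drop (e * B) (as @ [j])))))))"
    unfolding add_Suc_right by (subst E_play_adv_Suc) (use Suc.prems in auto)
  also have "\<dots> = E (play alg (adv \<theta>) (e * B + k))
      (\<lambda>(ms, as, ls). hit ?Y i (Suc k') (e * B + k) (last ms) (set (drop (e * B) as)))"
  proof (rule E_cong, clarify)
    fix ms as ls assume "(ms, as, ls) \<in> set_pmf (play alg (adv \<theta>) (e * B + k))"
    hence len: "length as = e * B + k" by (auto dest: play_lengths)
    have act: "active n B \<theta> as = ?Y - set (drop (e * B) as)"
      by (rule active_epoch[OF len]) (use Suc.prems in simp)
    have "set (drop (e * B) (as @ [j])) = insert j (set (drop (e * B) as))" for j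
      using len by simp
    thus "E (pick alg (Suc (e * B + k)) (last ms)) (\<lambda>j. E (day_losses n q (active n B \<theta> as))
          (\<lambda>l. E (update alg (Suc (e * B + k)) (last ms) j l)
            (\<lambda>m. hit ?Y i k' (Suc (e * B + k)) m (set (drop (e * B) (as @ [j]))))))
        = hit ?Y i (Suc k') (e * B + k) (last ms) (set (drop (e * B) as))"
      unfolding act by simp
  qed
  also have "\<dots> = E (play alg (adv \<theta>) (e * B))
      (\<lambda>(ms, as, ls). hit ?Y i (k + Suc k') (e * B) (last ms) {})"
    by (rule Suc.IH) (use Suc.prems in auto)
  finally show ?case by (simp only: add_Suc_right add_Suc)
qed

definition hits where
  "hits \<theta> e k = E (play alg (adv \<theta>) (e * B + k))
     (\<lambda>(ms, as, ls). real (card (targets \<theta> e \<inter> set (drop (e * B) as))))"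

definition state where
  "state \<theta> e = map_pmf (\<lambda>(ms, as, ls). last ms) (play alg (adv \<theta>) (e * B))"

lemma finite_targets [simp]: "finite (targets \<theta> e)"
  by (simp add: targets_def)

lemma set_state: "set_pmf (state \<theta> e) \<subseteq> R (e * B)"
  unfolding state_def using play_R_adv by auto

lemma finite_state: "e * B \<le> T \<Longrightarrow> finite (set_pmf (state \<theta> e))"
  by (rule finite_subset[OF set_state R_finite])

lemma hits_0 [simp]: "hits \<theta> e 0 = 0"
proof -
  have "hits \<theta> e 0 = E (play alg (adv \<theta>) (e * B)) (\<lambda>_. 0)"
    unfolding hits_def by (simp only: add_0_right, rule E_cong) (auto dest: play_lengths)
  thus ?thesis by simp
qed

lemma hits_eq:
  assumes "e * B + k \<le> T" "k \<le> B"
  shows "hits \<theta> e k = E (state \<theta> e) (\<lambda>m. \<Sum>i\<in>targets \<theta> e. hit (targets \<theta> e) i k (e * B) m {})"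
proof -
  let ?Y = "targets \<theta> e"
  have fin: "finite (set_pmf (play alg (adv \<theta>) (e * B + k)))"
    and fin0: "finite (set_pmf (play alg (adv \<theta>) (e * B)))"
    using assms by (auto intro!: finite_play_adv)
  have "hits \<theta> e k = E (play alg (adv \<theta>) (e * B + k)) (\<lambda>x. \<Sum>i\<in>?Y.
      (case x of (ms, as, ls) \<Rightarrow> hit ?Y i 0 (e * B + k) (last ms) (set (drop (e * B) as))))"
    unfolding hits_def by (rule E_cong) (auto simp: Int_def)
  also have "\<dots> = (\<Sum>i\<in>?Y. E (play alg (adv \<theta>) (e * B)) (\<lambda>(ms, as, ls). hit ?Y i (k + 0) (e * B) (last ms) {}))"
    unfolding E_sum[OF fin] by (intro sum.cong refl E_play_hit) (use assms in auto)
  also have "\<dots> = E (state \<theta> e) (\<lambda>m. \<Sum>i\<in>?Y. hit ?Y i k (e * B) m {})"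
    unfolding state_def by (simp add: E_sum[OF fin0] case_prod_unfold)
  finally show ?thesis .
qed

lemma adv_upd:
  assumes "length as < e * B"
  shows "adv (\<theta>((Suc e, i) := b)) as ls = adv \<theta> as ls"
proof -
  have "length as div B \<noteq> e" using assms B by (metis div_times_less_eq_dividend not_le)
  thus ?thesis by (auto simp: adv_def hiding_adversary_def active_def row_def Let_def)
qed

text \<open>The decoys of epoch \<open>e\<close> are not consulted before it begins. This is the
  independence required by \<open>sum_row_hit_le\<close>.\<close>

lemma state_upd: "state (\<theta>((Suc e, i) := b)) e = state \<theta> e"
  unfolding state_def by (subst play_cong[OF adv_upd]) auto

lemma state_0: "state \<theta> 0 = init alg"
  by (simp add: state_def pmf.map_comp o_def)

definition rate where "rate = 2 * p * (3/2 + q * (4/3 * ln N))"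

lemma rate_nonneg: "0 \<le> rate"
  unfolding rate_def using p q N by (intro mult_nonneg_nonneg add_nonneg_nonneg) auto

text \<open>Decoy hits are bounded by independence from the starting state, hits of good experts by
  comparison with decoy hits; experts in both rows are counted twice. The factor 2 in
  \<open>rate\<close> stands for the two rows.\<close>

lemma E_hits_le:
  assumes k: "e * B + k \<le> T" "k \<le> B" and "0 < s"
  shows "E params (\<lambda>\<theta>. hits \<theta> e k) \<le> real k * rate + of_bool (0 < e) * (ln N / s + s * (p * real n))"
proof -
  have "e \<le> e * B" using B by simp
  hence "e \<le> T" using k(1) by linarith
  hence A: "finite {..Suc T}" "0 \<in> {..Suc T}" "Suc e \<in> {..Suc T}" by auto
  have p': "0 \<le> p" using p by simp
  define H where "H m Y i = hit Y i k (e * B) m {}" for m Y i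
  define S where "S r = E params (\<lambda>\<theta>. E (state \<theta> e) (\<lambda>m. \<Sum>i\<in>row n \<theta> r. H m (targets \<theta> e) i))" for r
  have fin: "finite (set_pmf (state \<theta> e))" for \<theta>
    by (rule finite_state) (use k in simp)
  have H: "0 \<le> H m Y i \<and> H m Y i \<le> 1" if "m \<in> R (e * B)" for m Y i
    unfolding H_def by (rule hit_bounds) (use k that in auto)
  have "E params (\<lambda>\<theta>. hits \<theta> e k)
      \<le> E params (\<lambda>\<theta>. E (state \<theta> e) (\<lambda>m. (\<Sum>i\<in>row n \<theta> 0. H m (targets \<theta> e) i)
          + (\<Sum>i\<in>row n \<theta> (Suc e). H m (targets \<theta> e) i)))"
  proof (rule E_mono[OF finite_params])
    fix \<theta>
    show "hits \<theta> e k \<le> E (state \<theta> e) (\<lambda>m. (\<Sum>i\<in>row n \<theta> 0. H m (targets \<theta> e) i)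
          + (\<Sum>i\<in>row n \<theta> (Suc e). H m (targets \<theta> e) i))"
      unfolding hits_eq[OF k]
    proof (rule E_mono[OF fin])
      fix m assume "m \<in> set_pmf (state \<theta> e)"
      hence m: "m \<in> R (e * B)" using set_state by blast
      have "(\<Sum>i\<in>targets \<theta> e. H m (targets \<theta> e) i) + (\<Sum>i\<in>row n \<theta> 0 \<inter> row n \<theta> (Suc e). H m (targets \<theta> e) i)
          = (\<Sum>i\<in>row n \<theta> 0. H m (targets \<theta> e) i) + (\<Sum>i\<in>row n \<theta> (Suc e). H m (targets \<theta> e) i)"
        unfolding targets_def by (rule sum.union_inter) auto
      moreover have "0 \<le> (\<Sum>i\<in>row n \<theta> 0 \<inter> row n \<theta> (Suc e). H m (targets \<theta> e) i)"
        by (intro sum_nonneg) (use H[OF m] in blast)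
      ultimately show "(\<Sum>i\<in>targets \<theta> e. hit (targets \<theta> e) i k (e * B) m {})
          \<le> (\<Sum>i\<in>row n \<theta> 0. H m (targets \<theta> e) i) + (\<Sum>i\<in>row n \<theta> (Suc e). H m (targets \<theta> e) i)"
        unfolding H_def by linarith
    qed
  qed
  also have "\<dots> = S 0 + S (Suc e)"
    unfolding S_def by (simp only: E_add[OF fin] E_add[OF finite_params])
  finally have le: "E params (\<lambda>\<theta>. hits \<theta> e k) \<le> S 0 + S (Suc e)" .
  have decoy: "S (Suc e) \<le> real k * rate / 2"
  proof -
    have "S (Suc e) \<le> p * (real k * (3/2 + q * (4/3 * ln N)))"
      unfolding S_def H_def params_def targets_def Un_commute[of "row n _ 0"]
      by (rule sum_row_hit_le[OF A(1,3) p' p(2) k(1) set_state state_upd]) simp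
    thus ?thesis by (simp add: rate_def algebra_simps)
  qed
  have good: "S 0 \<le> S (Suc e) + of_bool (0 < e) * (ln N / s + s * (p * real n))" if "0 < e"
  proof -
    have "E params (\<lambda>\<theta>. E (state \<theta> e) (\<lambda>m. (\<Sum>i\<in>row n \<theta> 0. H m (targets \<theta> e) i)
        - (\<Sum>i\<in>row n \<theta> (Suc e). H m (targets \<theta> e) i))) \<le> ln N / s + s * (p * real n)"
      unfolding params_def targets_def
      by (rule rows_indistinguishable[OF A p' p(2) \<open>0 < s\<close> _ _ N set_state H])
        (use R_finite R_card k in auto)
    thus ?thesis using that unfolding S_def by (simp add: E_diff[OF fin] E_diff[OF finite_params])
  qed
  \<comment> \<open>In epoch 0 the state is drawn from \<open>init alg\<close>, independent of row 0
    as well, so good experts are treated directly and no cost of comparison arises.\<close>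
  have good0: "S 0 \<le> real k * rate / 2" if "e = 0"
  proof -
    have "S 0 \<le> p * (real k * (3/2 + q * (4/3 * ln N)))"
      unfolding S_def H_def params_def targets_def
      by (rule sum_row_hit_le[OF A(1,2) p' p(2) k(1) set_state]) (use that in \<open>simp_all add: state_0\<close>)
    thus ?thesis by (simp add: rate_def algebra_simps)
  qed
  show ?thesis using le decoy good good0 by (cases "e = 0") auto
qed

section \<open>From rare hits to regret\<close>

definition played where
  "played \<theta> t = E (play alg (adv \<theta>) t)
     (\<lambda>(ms, as, ls). E (pick alg (Suc t) (last ms)) (\<lambda>j. of_bool (j \<in> active n B \<theta> as)))"

text \<open>An active expert is a target not yet played in the epoch, so profiting from a bias is
  the same event as increasing the number of distinct targets hit.\<close>

lemma played_eq:
  assumes "Suc (e * B + k) \<le> T" "k < B"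
  shows "played \<theta> (e * B + k) = hits \<theta> e (Suc k) - hits \<theta> e k"
proof -
  let ?Y = "targets \<theta> e"
  have fin: "finite (set_pmf (play alg (adv \<theta>) (e * B + k)))"
    by (rule finite_play_adv) (use assms in simp)
  have "hits \<theta> e (Suc k) = E (play alg (adv \<theta>) (e * B + k)) (\<lambda>(ms, as, ls).
      E (pick alg (Suc (e * B + k)) (last ms)) (\<lambda>j. real (card (?Y \<inter> set (drop (e * B) (as @ [j]))))))"
    unfolding hits_def add_Suc_right by (subst E_play_adv_Suc[OF assms(1)]) simp
  also have "\<dots> = E (play alg (adv \<theta>) (e * B + k)) (\<lambda>x.
      (case x of (ms, as, ls) \<Rightarrow> real (card (?Y \<inter> set (drop (e * B) as))))
      + (case x of (ms, as, ls) \<Rightarrow> E (pick alg (Suc (e * B + k)) (last ms)) (\<lambda>j. of_bool (j \<in> active n B \<theta> as))))"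
  proof (rule E_cong, clarify)
    fix ms as ls assume x: "(ms, as, ls) \<in> set_pmf (play alg (adv \<theta>) (e * B + k))"
    hence len: "length as = e * B + k" by (auto dest: play_lengths)
    note finP = finite_pick[OF play_R_adv[OF x]]
    have "real (card (?Y \<inter> set (drop (e * B) (as @ [j]))))
        = real (card (?Y \<inter> set (drop (e * B) as))) + of_bool (j \<in> active n B \<theta> as)" for j
    proof -
      have "?Y \<inter> set (drop (e * B) (as @ [j])) = (if j \<in> active n B \<theta> as
          then insert j (?Y \<inter> set (drop (e * B) as)) else ?Y \<inter> set (drop (e * B) as))"
        using len by (auto simp: active_epoch[OF len assms(2)])
      thus ?thesis using len by (auto simp: active_epoch[OF len assms(2)])
    qed
    thus "E (pick alg (Suc (e * B + k)) (last ms)) (\<lambda>j. real (card (?Y \<inter> set (drop (e * B) (as @ [j])))))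
        = real (card (?Y \<inter> set (drop (e * B) as)))
          + E (pick alg (Suc (e * B + k)) (last ms)) (\<lambda>j. of_bool (j \<in> active n B \<theta> as))"
      by (simp only: E_add[OF finP]) simp
  qed
  also have "\<dots> = hits \<theta> e k + played \<theta> (e * B + k)"
    unfolding hits_def played_def by (rule E_add[OF fin])
  finally show ?thesis by simp
qed

text \<open>Dividing by at least \<open>p * n\<close> instead of the random number \<open>c\<close>
  of good experts bounds the loss per spoiled expert by \<open>1 / (p * n)\<close> even if
  \<open>c\<close> is small or 0. The mass left over goes to expert 0, an arbitrary choice.\<close>

definition weight where
  "weight \<theta> i = (let c = real (card (row n \<theta> 0)); g = max (p * real n) c in
     of_bool (i \<in> row n \<theta> 0) / g + of_bool (i = 0) * (1 - c / g))"

definition share where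
  "share \<theta> = real (card (row n \<theta> 0)) / max (p * real n) (real (card (row n \<theta> 0)))"

lemma pn: "0 < p * real n"
  using p n_pos by simp

lemma share_le: "share \<theta> \<le> 1"
  using pn by (simp add: share_def divide_le_eq)

lemma sum_weight: "(\<Sum>i<n. weight \<theta> i * f i)
    = (\<Sum>i\<in>row n \<theta> 0. f i) / max (p * real n) (real (card (row n \<theta> 0))) + (1 - share \<theta>) * f 0"
proof -
  have "(\<Sum>i<n. weight \<theta> i * f i) = (\<Sum>i<n. of_bool (\<theta> (0, i)) * f i / max (p * real n) (real (card (row n \<theta> 0)))
      + (if i = 0 then (1 - share \<theta>) * f 0 else 0))"
    by (intro sum.cong refl) (auto simp: weight_def share_def Let_def row_def distrib_right)
  thus ?thesis using n_pos by (simp add: sum.distrib sum_row flip: sum_divide_distrib)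
qed

lemma weight_nonneg: "0 \<le> weight \<theta> i"
  using share_le[of \<theta>] pn by (simp add: weight_def share_def Let_def)

lemma weight_sum: "(\<Sum>i<n. weight \<theta> i) = 1"
  using sum_weight[of \<theta> "\<lambda>_. 1"] by (simp add: share_def)

definition good where
  "good \<theta> t = E (play alg (adv \<theta>) t) (\<lambda>(ms, as, ls). \<Sum>i<n. weight \<theta> i * of_bool (i \<in> active n B \<theta> as))"

text \<open>A good expert is inactive only after being played in this epoch, which makes it one of
  the hits, and it takes away weight at most \<open>1 / (p * n)\<close>.\<close>

lemma good_ge:
  assumes "e * B + k \<le> T" "k < B"
  shows "share \<theta> - hits \<theta> e k / (p * real n) \<le> good \<theta> (e * B + k)"
proof -
  let ?G = "row n \<theta> 0" and ?g = "max (p * real n) (real (card (row n \<theta> 0)))"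
  have fin: "finite (set_pmf (play alg (adv \<theta>) (e * B + k)))"
    by (rule finite_play_adv[OF assms(1)])
  have "share \<theta> - hits \<theta> e k / (p * real n) = E (play alg (adv \<theta>) (e * B + k))
     (\<lambda>x. share \<theta> - (case x of (ms, as, ls) \<Rightarrow> real (card (targets \<theta> e \<inter> set (drop (e * B) as)))) / (p * real n))"
    unfolding hits_def by (simp add: E_diff[OF fin])
  also have "\<dots> \<le> good \<theta> (e * B + k)"
    unfolding good_def
  proof (rule E_mono[OF fin], clarify)
    fix ms as ls assume "(ms, as, ls) \<in> set_pmf (play alg (adv \<theta>) (e * B + k))"
    hence len: "length as = e * B + k" by (auto dest: play_lengths)
    let ?D = "set (drop (e * B) as)"
    have "card ?G \<le> card (?G \<inter> active n B \<theta> as) + card (targets \<theta> e \<inter> ?D)"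
    proof -
      have "?G \<subseteq> (?G \<inter> active n B \<theta> as) \<union> (targets \<theta> e \<inter> ?D)"
        by (auto simp: active_epoch[OF len assms(2)] targets_def)
      hence "card ?G \<le> card ((?G \<inter> active n B \<theta> as) \<union> (targets \<theta> e \<inter> ?D))"
        by (intro card_mono) auto
      also have "\<dots> \<le> card (?G \<inter> active n B \<theta> as) + card (targets \<theta> e \<inter> ?D)" by (rule card_Un_le)
      finally show ?thesis .
    qed
    hence "real (card ?G) \<le> real (card (?G \<inter> active n B \<theta> as)) + real (card (targets \<theta> e \<inter> ?D))"
      by simp
    hence "share \<theta> \<le> (real (card (?G \<inter> active n B \<theta> as)) + real (card (targets \<theta> e \<inter> ?D))) / ?g"
      unfolding share_def using pn by (intro divide_right_mono) auto
    also have "\<dots> \<le> real (card (?G \<inter> active n B \<theta> as)) / ?g + real (card (targets \<theta> e \<inter> ?D)) / (p * real n)"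
      unfolding add_divide_distrib using pn by (intro add_left_mono divide_left_mono) auto
    also have "real (card (?G \<inter> active n B \<theta> as)) / ?g \<le> (\<Sum>i<n. weight \<theta> i * of_bool (i \<in> active n B \<theta> as))"
      unfolding sum_weight using share_le[of \<theta>] by (simp add: Int_def)
    finally show "share \<theta> - real (card (targets \<theta> e \<inter> ?D)) / (p * real n)
        \<le> (\<Sum>i<n. weight \<theta> i * of_bool (i \<in> active n B \<theta> as))" by simp
  qed
  finally show ?thesis .
qed

text \<open>On every day an active expert has mean loss \<open>q / 4\<close> and any other
  \<open>q / 2\<close>, so the algorithm and the mixture differ by \<open>q / 4\<close> times the
  difference of their chances of being on an active expert.\<close>

lemma E_play_losses:
  "t \<le> T \<Longrightarrow> E (play alg (adv \<theta>) t)
      (\<lambda>(ms, as, ls). \<Sum>s<length ls. (ls ! s) (as ! s) - (\<Sum>i<n. weight \<theta> i * (ls ! s) i))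
    = (\<Sum>s<t. q / 4 * (good \<theta> s - played \<theta> s))"
proof (induction t)
  case 0
  show ?case by simp
next
  case (Suc t)
  define f where "f as ls = (\<Sum>s<length ls. (ls ! s) (as ! s) - (\<Sum>i<n. weight \<theta> i * (ls ! s) i))"
    for as and ls :: "loss list"
  have fin: "finite (set_pmf (play alg (adv \<theta>) t))"
    by (rule finite_play_adv) (use Suc in simp)
  have "E (play alg (adv \<theta>) (Suc t)) (\<lambda>(ms, as, ls). f as ls)
      = E (play alg (adv \<theta>) t) (\<lambda>(ms, as, ls). E (pick alg (Suc t) (last ms))
          (\<lambda>j. E (day_losses n q (active n B \<theta> as)) (\<lambda>l. f (as @ [j]) (ls @ [l]))))"
    by (subst E_play_adv_Suc[OF Suc.prems]) simp
  also have "\<dots> = E (play alg (adv \<theta>) t) (\<lambda>x. (case x of (ms, as, ls) \<Rightarrow> f as ls)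
      + q / 4 * ((case x of (ms, as, ls) \<Rightarrow> \<Sum>i<n. weight \<theta> i * of_bool (i \<in> active n B \<theta> as))
        - (case x of (ms, as, ls) \<Rightarrow> E (pick alg (Suc t) (last ms)) (\<lambda>j. of_bool (j \<in> active n B \<theta> as)))))"
  proof (rule E_cong, clarify)
    fix ms as ls assume x: "(ms, as, ls) \<in> set_pmf (play alg (adv \<theta>) t)"
    hence len: "length as = t" "length ls = t" by (auto dest: play_lengths)
    note finP = finite_pick[OF play_R_adv[OF x]]
    let ?A = "active n B \<theta> as"
    let ?w = "\<Sum>i<n. weight \<theta> i * of_bool (i \<in> ?A)"
    have step: "E (day_losses n q ?A) (\<lambda>l. f (as @ [j]) (ls @ [l])) = f as ls + q / 4 * (?w - of_bool (j \<in> ?A))"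
      if j: "j \<in> set_pmf (pick alg (Suc t) (last ms))" for j
    proof -
      have "j < n" using j R_pick[OF play_R_adv[OF x]] by auto
      have "f (as @ [j]) (ls @ [l]) = f as ls + (l j - (\<Sum>i<n. weight \<theta> i * l i))" for l
        using len by (simp add: f_def nth_append)
      hence "E (day_losses n q ?A) (\<lambda>l. f (as @ [j]) (ls @ [l]))
          = f as ls + (E (day_losses n q ?A) (\<lambda>l. l j) - (\<Sum>i<n. weight \<theta> i * E (day_losses n q ?A) (\<lambda>l. l i)))"
        by (simp add: E_add E_diff E_sum)
      also have "(\<Sum>i<n. weight \<theta> i * E (day_losses n q ?A) (\<lambda>l. l i))
          = (\<Sum>i<n. q / 2 * weight \<theta> i - q / 4 * (weight \<theta> i * of_bool (i \<in> ?A)))"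
        by (intro sum.cong refl) (simp add: E_day_losses_component[OF q] algebra_simps)
      also have "\<dots> = q / 2 - q / 4 * ?w"
        by (simp only: sum_subtractf sum_distrib_left[symmetric] weight_sum mult_1_right)
      finally show ?thesis
        by (simp add: E_day_losses_component[OF q \<open>j < n\<close>] algebra_simps)
    qed
    have "E (pick alg (Suc t) (last ms)) (\<lambda>j. E (day_losses n q ?A) (\<lambda>l. f (as @ [j]) (ls @ [l])))
        = E (pick alg (Suc t) (last ms)) (\<lambda>j. f as ls + q / 4 * (?w - of_bool (j \<in> ?A)))"
      by (rule E_cong[OF step])
    also have "\<dots> = f as ls + q / 4 * (?w - E (pick alg (Suc t) (last ms)) (\<lambda>j. of_bool (j \<in> ?A)))"
      by (simp add: E_add[OF finP] E_diff[OF finP])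
    finally show "E (pick alg (Suc t) (last ms)) (\<lambda>j. E (day_losses n q ?A) (\<lambda>l. f (as @ [j]) (ls @ [l]))) = \<dots>" .
  qed
  also have "\<dots> = E (play alg (adv \<theta>) t) (\<lambda>(ms, as, ls). f as ls) + q / 4 * (good \<theta> t - played \<theta> t)"
    unfolding good_def played_def by (simp only: E_add[OF fin] E_diff[OF fin] integral_mult_right_zero)
  also have "E (play alg (adv \<theta>) t) (\<lambda>(ms, as, ls). f as ls) = (\<Sum>s<t. q / 4 * (good \<theta> s - played \<theta> s))"
    unfolding f_def by (rule Suc.IH) (use Suc.prems in simp)
  finally show ?case unfolding f_def by simp
qed

lemma regret_ge: "(\<Sum>s<T. q / 4 * (good \<theta> s - played \<theta> s)) \<le> regret n T alg (adv \<theta>)"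
proof -
  have "(\<Sum>s<T. q / 4 * (good \<theta> s - played \<theta> s)) = E (play alg (adv \<theta>) T)
      (\<lambda>(ms, as, ls). \<Sum>s<length ls. (ls ! s) (as ! s) - (\<Sum>i<n. weight \<theta> i * (ls ! s) i))"
    by (simp add: E_play_losses)
  also have "\<dots> \<le> regret n T alg (adv \<theta>)"
    unfolding regret_def
    by (intro E_mono finite_play_adv)
      (auto intro!: realized_regret_ge n_pos weight_nonneg weight_sum)
  finally show ?thesis .
qed

lemma E_share_ge: "3/4 - 1 / (4 * (p * real n)) \<le> E params share"
proof -
  let ?c = "\<lambda>\<theta>. real (card (row n \<theta> 0))"
  have p': "0 \<le> p" using p by simp
  let ?g = "p * real n"
  have sq: "E params (\<lambda>\<theta>. (?c \<theta>)\<^sup>2) \<le> ?g * (1 + ?g)" and m: "E params ?c = ?g"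
    unfolding params_def using E_card_row_square_le[of "{..Suc T}" 0 p n] p p' by auto
  have "3/4 - 1 / (4 * ?g) = ?g / ?g - ?g * (1 + ?g) / (4 * ?g\<^sup>2)"
    using p n_pos by (simp add: field_simps power2_eq_square)
  also have "\<dots> \<le> E params ?c / ?g - E params (\<lambda>\<theta>. (?c \<theta>)\<^sup>2) / (4 * ?g\<^sup>2)"
    unfolding m by (intro diff_left_mono divide_right_mono sq) auto
  also have "\<dots> = E params (\<lambda>\<theta>. ?c \<theta> / ?g - (?c \<theta>)\<^sup>2 / (4 * ?g\<^sup>2))"
    by (simp add: E_diff)
  also have "\<dots> \<le> E params share"
    unfolding share_def by (intro E_mono min_ratio_ge pn) auto
  finally show ?thesis .
qed

text \<open>The bound \<open>r\<close> holds for each \<open>\<theta>\<close>, hence also on average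
  over \<open>params\<close>. The terms for hits carry a factor 2 because a hit counts twice: it
  profits the algorithm, and it may spoil a good expert of the mixture.\<close>

lemma regret_lower_bound:
  assumes "0 < s" and r: "\<And>\<theta>. regret n T alg (adv \<theta>) \<le> r"
  shows "q / 4 * real T * (3/4 - 1 / (4 * (p * real n)) - 2 * rate - 2 * (ln N / s + s * (p * real n)) / real B) \<le> r"
proof -
  define err where "err = ln N / s + s * (p * real n)"
  define x where "x e k = E params (\<lambda>\<theta>. hits \<theta> e k)" for e k
  have err: "0 \<le> err" unfolding err_def using N \<open>0 < s\<close> pn by (intro add_nonneg_nonneg) auto
  have x: "x e k \<le> real k * rate + of_bool (0 < e) * err" if "e * B + k \<le> T" "k \<le> B" for e k
    unfolding x_def err_def by (rule E_hits_le[OF that \<open>0 < s\<close>])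
  have x0: "x e 0 = 0" for e by (simp add: x_def)
  have T_split: "T div B * B + T mod B = T" by simp
  have played: "(\<Sum>t<T. E params (\<lambda>\<theta>. played \<theta> t)) \<le> real T * rate + real (T div B) * err"
  proof -
    have "(\<Sum>t<T. E params (\<lambda>\<theta>. played \<theta> t))
        = (\<Sum>t<T. x (t div B) (Suc (t mod B)) - x (t div B) (t mod B))"
    proof (rule sum.cong[OF refl])
      fix t assume "t \<in> {..<T}"
      hence "played \<theta> t = hits \<theta> (t div B) (Suc (t mod B)) - hits \<theta> (t div B) (t mod B)" for \<theta>
        using played_eq[of "t div B" "t mod B" \<theta>] B by simp
      thus "E params (\<lambda>\<theta>. played \<theta> t) = x (t div B) (Suc (t mod B)) - x (t div B) (t mod B)"
        unfolding x_def by (simp add: E_diff)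
    qed
    also have "\<dots> = (\<Sum>e<T div B. x e B) + x (T div B) (T mod B)"
      by (rule sum_epochs[of B x, OF B x0])
    also have "\<dots> \<le> (\<Sum>e<T div B. real B * rate + of_bool (0 < e) * err)
        + (real (T mod B) * rate + of_bool (0 < T div B) * err)"
    proof (intro add_mono sum_mono x)
      fix e assume "e \<in> {..<T div B}"
      hence "Suc e * B \<le> T div B * B" by (intro mult_le_mono1) simp
      hence "Suc e * B \<le> T" using div_times_less_eq_dividend[of T B] by linarith
      thus "e * B + B \<le> T" by simp
    qed (use T_split B in \<open>auto intro: less_imp_le\<close>)
    also have "\<dots> = (real (T div B) * real B + real (T mod B)) * rate
        + ((\<Sum>e<T div B. of_bool (0 < e)) + of_bool (0 < T div B)) * err"
      by (simp add: sum.distrib algebra_simps flip: sum_distrib_right)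
    \<comment> \<open>Since epoch 0 is exempt, \<open>E'\<close> full epochs and a partial one are
      charged only \<open>E'\<close> times. This keeps the total below \<open>T / B * err\<close>
      even when \<open>T < B\<close>.\<close>
    also have "(\<Sum>e<E'. of_bool (0 < e)) + of_bool (0 < E') = real E'" for E' :: nat
      by (induction E') auto
    also have "real (T div B) * real B + real (T mod B) = real T"
      using T_split by (simp only: flip: of_nat_mult of_nat_add)
    finally show ?thesis .
  qed
  have good: "real T * (E params share - (rate + err / real B)) \<le> (\<Sum>t<T. E params (\<lambda>\<theta>. good \<theta> t))"
  proof -
    have "E params share - (rate + err / real B) \<le> E params (\<lambda>\<theta>. good \<theta> t)" if "t < T" for t
    proof -
      let ?e = "t div B" and ?k = "t mod B"
      have k: "?e * B + ?k = t" "?k < B" using B by auto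
      have "x ?e ?k \<le> real ?k * rate + of_bool (0 < ?e) * err"
        by (rule x) (use k that in auto)
      also have "\<dots> \<le> real B * rate + 1 * err"
        by (intro add_mono mult_right_mono rate_nonneg err) (use k in auto)
      finally have "x ?e ?k / (p * real n) \<le> (real B * rate + err) / (p * real n)"
        using pn by (intro divide_right_mono) auto
      also have "\<dots> \<le> (real B * rate + err) / real B"
        using B B_le pn rate_nonneg err by (intro divide_left_mono) auto
      also have "\<dots> = rate + err / real B" using B by (simp add: field_simps)
      finally have "E params share - (rate + err / real B) \<le> E params share - x ?e ?k / (p * real n)" by simp
      also have "\<dots> = E params (\<lambda>\<theta>. share \<theta> - hits \<theta> ?e ?k / (p * real n))"
        unfolding x_def by (simp add: E_diff)
      also have "\<dots> \<le> E params (\<lambda>\<theta>. good \<theta> t)"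
        by (rule E_mono[OF finite_params]) (use good_ge[of ?e ?k] k that in simp)
      finally show ?thesis .
    qed
    hence "(\<Sum>t<T. E params share - (rate + err / real B)) \<le> (\<Sum>t<T. E params (\<lambda>\<theta>. good \<theta> t))"
      by (intro sum_mono) auto
    thus ?thesis by simp
  qed
  have "real (T div B) \<le> real T / real B"
    by (rule of_nat_div_le_of_nat)
  hence "real (T div B) * err \<le> real T / real B * err" using err by (rule mult_right_mono)
  moreover have "real T * (E params share - 2 * rate - 2 * err / real B)
      = real T * (E params share - (rate + err / real B)) - real T * rate - real T / real B * err"
    by (simp add: field_simps)
  ultimately have "real T * (E params share - 2 * rate - 2 * err / real B)
      \<le> (\<Sum>t<T. E params (\<lambda>\<theta>. good \<theta> t)) - (\<Sum>t<T. E params (\<lambda>\<theta>. played \<theta> t))"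
    using good played by linarith
  moreover have "real T * (3/4 - 1 / (4 * (p * real n)) - 2 * rate - 2 * err / real B)
      \<le> real T * (E params share - 2 * rate - 2 * err / real B)"
    by (intro mult_left_mono diff_right_mono E_share_ge) auto
  ultimately have "q / 4 * (real T * (3/4 - 1 / (4 * (p * real n)) - 2 * rate - 2 * err / real B))
      \<le> q / 4 * ((\<Sum>t<T. E params (\<lambda>\<theta>. good \<theta> t)) - (\<Sum>t<T. E params (\<lambda>\<theta>. played \<theta> t)))"
    using q by (intro mult_left_mono) auto
  also have "\<dots> = E params (\<lambda>\<theta>. \<Sum>t<T. q / 4 * (good \<theta> t - played \<theta> t))"
    by (simp only: E_sum[OF finite_params] E_diff[OF finite_params] integral_mult_right_zero
        sum_subtractf sum_distrib_left[symmetric])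
  also have "\<dots> \<le> r"
    by (rule E_le_const[OF finite_params order.trans[OF regret_ge r]])
  finally show ?thesis unfolding err_def by (simp add: mult.assoc)
qed

end

section \<open>Bounded space\<close>

text \<open>The union over all adversaries makes the set independent of \<open>\<theta>\<close>, so
  that one family \<open>R\<close> of bounded size serves every hiding adversary.\<close>

definition reachable :: "nat \<Rightarrow> experts_algorithm \<Rightarrow> nat \<Rightarrow> memory set" where
  "reachable n alg t =
     {last ms | ms as ls adv. adaptive_adversary n adv \<and> (ms, as, ls) \<in> set_pmf (play alg adv t)}"

lemma reachableI:
  "adaptive_adversary n adv \<Longrightarrow> (ms, as, ls) \<in> set_pmf (play alg adv t) \<Longrightarrow> last ms \<in> reachable n alg t"
  unfolding reachable_def by blast

lemma play_Suc_I:
  assumes "(ms, as, ls) \<in> set_pmf (play alg adv t)" "l \<in> set_pmf (adv as ls)"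
    "i \<in> set_pmf (pick alg (Suc t) (last ms))" "m \<in> set_pmf (update alg (Suc t) (last ms) i l)"
  shows "(ms @ [m], as @ [i], ls @ [l]) \<in> set_pmf (play alg adv (Suc t))"
  using assms by (auto intro!: bexI[of _ "(ms, as, ls)"])

lemma play_extend:
  assumes "(ms, as, ls) \<in> set_pmf (play alg adv t)"
  shows "\<exists>ms' as' ls'. (ms @ ms', as', ls') \<in> set_pmf (play alg adv (t + k))"
proof (induction k)
  case 0
  show ?case using assms by (intro exI[of _ "[]"] exI) simp
next
  case (Suc k)
  then obtain ms' as' ls' where *: "(ms @ ms', as', ls') \<in> set_pmf (play alg adv (t + k))" by blast
  obtain l where l: "l \<in> set_pmf (adv as' ls')" by (meson set_pmf_not_empty ex_in_conv)
  obtain i where i: "i \<in> set_pmf (pick alg (Suc (t + k)) (last (ms @ ms')))"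
    by (meson set_pmf_not_empty ex_in_conv)
  obtain m where m: "m \<in> set_pmf (update alg (Suc (t + k)) (last (ms @ ms')) i l)"
    by (meson set_pmf_not_empty ex_in_conv)
  show ?case using play_Suc_I[OF * l i m] unfolding add_Suc_right append_assoc by blast
qed

lemma play_nonempty: "(ms, as, ls) \<in> set_pmf (play alg adv t) \<Longrightarrow> ms \<noteq> []"
  by (cases t) auto

lemma reachable_init: "set_pmf (init alg) \<subseteq> reachable n alg 0"
proof
  fix m assume "m \<in> set_pmf (init alg)"
  hence "([m], [], []) \<in> set_pmf (play alg (hiding_adversary n 0 1 (\<lambda>_. False)) 0)" by simp
  from reachableI[OF adaptive_hiding_adversary this] show "m \<in> reachable n alg 0" by simp
qed

text \<open>An adversary that reaches \<open>m\<close> is modified to reveal \<open>l\<close> from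
  then on; the first \<open>t\<close> days are unaffected.\<close>

lemma reachable_update:
  assumes "m \<in> reachable n alg t" "j \<in> set_pmf (pick alg (Suc t) m)" "l \<in> loss_vectors n"
  shows "set_pmf (update alg (Suc t) m j l) \<subseteq> reachable n alg (Suc t)"
proof
  fix m' assume m': "m' \<in> set_pmf (update alg (Suc t) m j l)"
  obtain ms as ls adv where *: "adaptive_adversary n adv" "(ms, as, ls) \<in> set_pmf (play alg adv t)"
    "m = last ms"
    using assms(1) unfolding reachable_def by blast
  define adv' where "adv' as ls = (if length as < t then adv as ls else return_pmf l)" for as ls
  have "adaptive_adversary n adv'"
    using *(1) assms(3) unfolding adaptive_adversary_def adv'_def by simp
  moreover have "play alg adv' t = play alg adv t"
    by (rule play_cong) (simp add: adv'_def)
  hence "(ms @ [m'], as @ [j], ls @ [l]) \<in> set_pmf (play alg adv' (Suc t))"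
    using * assms(2) m' play_lengths[OF *(2)] by (intro play_Suc_I) (auto simp: adv'_def)
  ultimately have "last (ms @ [m']) \<in> reachable n alg (Suc t)" by (rule reachableI)
  thus "m' \<in> reachable n alg (Suc t)" by simp
qed

lemma reachable_memory_states:
  assumes "online_algorithm n b alg"
  shows "reachable n alg t \<subseteq> memory_states b"
proof -
  have "last ms \<in> memory_states b"
    if "adaptive_adversary n adv" "(ms, as, ls) \<in> set_pmf (play alg adv t)" for adv ms as ls
    using that(2)
  proof (induction t arbitrary: ms as ls)
    case 0
    thus ?case using assms by (auto simp: online_algorithm_def)
  next
    case (Suc t)
    then obtain ms' as' ls' l i m where *: "(ms', as', ls') \<in> set_pmf (play alg adv t)"
      "l \<in> set_pmf (adv as' ls')" "i \<in> set_pmf (pick alg (Suc t) (last ms'))"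
      "m \<in> set_pmf (update alg (Suc t) (last ms') i l)" "ms = ms' @ [m]"
      by auto
    have "last ms' \<in> memory_states b" by (rule Suc.IH[OF *(1)])
    moreover from this have "i < n" using assms *(3) unfolding online_algorithm_def by blast
    moreover have "l \<in> loss_vectors n" using *(2) that(1) unfolding adaptive_adversary_def by blast
    ultimately have "m \<in> memory_states b" using assms *(4) unfolding online_algorithm_def by blast
    thus ?case using *(5) by simp
  qed
  thus ?thesis unfolding reachable_def by blast
qed

text \<open>The space bound speaks of complete games, so a game of \<open>t\<close> days is first
  extended to \<open>T\<close> days.\<close>

lemma reachable_length:
  assumes "uses_space_at_most n T alg s" "t \<le> T" "m \<in> reachable n alg t"
  shows "real (length m) \<le> s"
proof -
  obtain ms as ls adv where *: "adaptive_adversary n adv" "(ms, as, ls) \<in> set_pmf (play alg adv t)"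
    "m = last ms"
    using assms(3) unfolding reachable_def by blast
  obtain ms' as' ls' where "(ms @ ms', as', ls') \<in> set_pmf (play alg adv T)"
    using play_extend[OF *(2), of "T - t"] assms(2) by auto
  hence "real (space_used (ms @ ms')) \<le> s"
    using assms(1) *(1) unfolding uses_space_at_most_def by fast
  moreover have "m \<in> set (ms @ ms')" using *(3) play_nonempty[OF *(2)] by simp
  hence "length m \<le> space_used (ms @ ms')" unfolding space_used_def by (intro Max_ge) auto
  ultimately show ?thesis by linarith
qed

text \<open>Words of length at most \<open>k\<close> can be padded to length \<open>k\<close> by one
  extra letter. Unlike the geometric formula, this bound needs no division and covers
  \<open>x = 1\<close>, the case of words of 0 bits.\<close>

lemma sum_power_le: "(\<Sum>i\<le>k. x ^ i) \<le> (x + 1) ^ k" for x :: nat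
proof (induction k)
  case (Suc k)
  have "x ^ k \<le> (x + 1) ^ k" by (rule power_mono) auto
  hence "x * x ^ k \<le> x * (x + 1) ^ k" by (rule mult_left_mono) simp
  hence "(\<Sum>i\<le>k. x ^ i) + x * x ^ k \<le> (x + 1) ^ k + x * (x + 1) ^ k" using Suc by linarith
  thus ?case by simp
qed simp

lemma learner_reachable:
  assumes "online_algorithm n b alg" "uses_space_at_most n T alg s" "0 \<le> q" "q \<le> 1"
  shows "learner n T q (2 ^ ((b + 1) * nat \<lfloor>s\<rfloor>)) alg (reachable n alg)"
proof
  define M where "M = {xs. set xs \<subseteq> {..<2 ^ b :: nat} \<and> length xs \<le> nat \<lfloor>s\<rfloor>}"
  have M: "reachable n alg t \<subseteq> M" if "t \<le> T" for t
  proof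
    fix m assume m: "m \<in> reachable n alg t"
    have "int (length m) \<le> \<lfloor>s\<rfloor>"
      using reachable_length[OF assms(2) that m] by (simp add: le_floor_iff)
    thus "m \<in> M" using reachable_memory_states[OF assms(1)] m
      by (auto simp: M_def memory_states_def)
  qed
  have finM: "finite M" unfolding M_def by (rule finite_lists_length_le) simp
  have "card M = (\<Sum>i\<le>nat \<lfloor>s\<rfloor>. (2 ^ b) ^ i)"
    unfolding M_def by (subst card_lists_length_le) auto
  also have "\<dots> \<le> (2 ^ b + 1) ^ nat \<lfloor>s\<rfloor>" by (rule sum_power_le)
  also have "\<dots> \<le> (2 ^ (b + 1)) ^ nat \<lfloor>s\<rfloor>" by (intro power_mono) simp_all
  finally have cardM: "card M \<le> 2 ^ ((b + 1) * nat \<lfloor>s\<rfloor>)" by (simp only: power_mult)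
  show "finite (reachable n alg t)" if "t \<le> T" for t
    by (rule finite_subset[OF M[OF that] finM])
  show "real (card (reachable n alg t)) \<le> 2 ^ ((b + 1) * nat \<lfloor>s\<rfloor>)" if "t \<le> T" for t
  proof -
    have "card (reachable n alg t) \<le> 2 ^ ((b + 1) * nat \<lfloor>s\<rfloor>)"
      using card_mono[OF finM M[OF that]] cardM by (rule le_trans)
    hence "real (card (reachable n alg t)) \<le> real (2 ^ ((b + 1) * nat \<lfloor>s\<rfloor>))"
      by (simp only: of_nat_le_iff)
    thus ?thesis by simp
  qed
  show "set_pmf (pick alg (Suc t) m) \<subseteq> {..<n}" if "m \<in> reachable n alg t" for t m
    using reachable_memory_states[OF assms(1)] that assms(1) unfolding online_algorithm_def by blast
  show "set_pmf (update alg (Suc t) m j l) \<subseteq> reachable n alg (Suc t)"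
    if "m \<in> reachable n alg t" "j \<in> set_pmf (pick alg (Suc t) m)" "l \<in> bit_vectors n" for t m j l
    by (rule reachable_update[OF that(1,2)]) (use that(3) bit_vectors_subset in blast)
qed (use assms reachable_init in auto)

section \<open>Numerical parameters and the asymptotic statement\<close>

lemma no_small_space_algorithm:
  fixes eps s :: real
  assumes n: "64 \<le> n" and T: "1 \<le> T" and eps: "64 / sqrt n < eps" "eps < 1 / 2"
    and space: "real (b + 1) * s \<le> sqrt n / eps / 10000"
    and alg: "online_algorithm n b alg" "uses_space_at_most n T alg s"
    and regret: "\<And>adv. adaptive_adversary n adv \<Longrightarrow> regret n T alg adv \<le> eps\<^sup>2 / 20 * real T"
  shows False
proof -
  define x where "x = sqrt n / eps"
  define p where "p = 1 / (eps * sqrt n)"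
  define q where "q = 4 * eps\<^sup>2"
  define B where "B = nat \<lfloor>x\<rfloor>"
  define N :: real where "N = 2 ^ ((b + 1) * nat \<lfloor>s\<rfloor>)"
  have sn: "8 \<le> sqrt n" using n by (intro real_le_rsqrt) simp
  have "0 < 64 / sqrt n" using n by simp
  hence eps0: "0 < eps" using eps by linarith
  have eps_sn: "64 < eps * sqrt n" using eps(1) n by (simp add: pos_divide_less_eq)
  have p: "0 < p" "p \<le> 1 / 64" unfolding p_def using eps_sn eps0 sn
    by (auto simp: field_simps)
  have pn_eq: "p * n = x" unfolding p_def x_def using eps0 n
    by (simp add: field_simps flip: power2_eq_square)
  have "8 * 2 \<le> sqrt n * (1 / eps)"
    using eps0 eps sn by (intro mult_mono) (auto simp: field_simps)
  hence x: "16 \<le> x" by (simp add: x_def)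
  have B: "real B \<le> x" "x / 2 \<le> real B" "0 < B"
    unfolding B_def using x by linarith+
  have "eps\<^sup>2 \<le> (1 / 2)\<^sup>2" using eps0 eps by (intro power_mono) auto
  hence q: "0 \<le> q" "q \<le> 1" by (auto simp: q_def power2_eq_square)
  \<comment> \<open>A negative \<open>s\<close> would make \<open>nat \<lfloor>s\<rfloor>\<close>
    exceed \<open>s\<close>; it is excluded because some initial state has a length.\<close>
  have s0: "0 \<le> s"
  proof -
    obtain m where "m \<in> set_pmf (init alg)" by (meson set_pmf_not_empty ex_in_conv)
    hence "m \<in> reachable n alg 0" using reachable_init by blast
    from reachable_length[OF alg(2) _ this] show ?thesis by linarith
  qed
  have lnN: "ln N \<le> x / 10000"
  proof -
    have "ln N = real ((b + 1) * nat \<lfloor>s\<rfloor>) * ln 2" unfolding N_def by (rule ln_realpow)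
    also have "\<dots> \<le> real ((b + 1) * nat \<lfloor>s\<rfloor>) * 1"
      by (intro mult_left_mono) (use ln_2_less_1 in auto)
    also have "\<dots> = real (b + 1) * real (nat \<lfloor>s\<rfloor>)" by (simp only: of_nat_mult mult_1_right)
    also have "\<dots> \<le> real (b + 1) * s" using s0 by (intro mult_left_mono) auto
    also have "\<dots> \<le> x / 10000" using space by (simp add: x_def)
    finally show ?thesis .
  qed
  have N1: "1 \<le> N" unfolding N_def by simp
  note p_le = p(2) and B_bounds = B
  interpret learner n T q N alg "reachable n alg"
    unfolding N_def by (rule learner_reachable[OF alg q])
  interpret hiding_game n T q N alg "reachable n alg" B p
    by unfold_locales (use p B pn_eq in auto)
  \<comment> \<open>The two contributions are \<open>3 * p <= 3 / 64\<close> and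
    \<open>32 / 3\<close> times \<open>ln N / x\<close>, since
    \<open>p * eps^2 * x = 1\<close>.\<close>
  have rate: "rate \<le> 1 / 16"
  proof -
    have "rate = 3 * p + 32 / 3 * (p * eps\<^sup>2 * ln N)"
      unfolding rate_def by (simp add: q_def algebra_simps)
    also have "p * eps\<^sup>2 * ln N \<le> p * eps\<^sup>2 * (x / 10000)"
      using p by (intro mult_left_mono lnN) auto
    also have "\<dots> = 1 / 10000" unfolding p_def x_def using eps0 n
      by (simp add: field_simps power2_eq_square)
    finally show ?thesis using p_le by simp
  qed
  \<comment> \<open>With \<open>s = 1 / 64\<close> the bracket is at most
    \<open>x * (64 / 10000 + 1 / 64)\<close>, less than \<open>x / 32\<close>, and
    \<open>B >= x / 2\<close>.\<close>
  have err: "2 * (ln N / (1 / 64) + 1 / 64 * (p * n)) / B \<le> 1 / 8"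
  proof -
    have "2 * (ln N / (1 / 64) + 1 / 64 * (p * n)) / B \<le> (x / 16) / B"
      unfolding pn_eq using lnN x by (intro divide_right_mono) auto
    also have "\<dots> \<le> (x / 16) / (x / 2)"
      using B_bounds x by (intro divide_left_mono) auto
    finally show ?thesis using x by simp
  qed
  have x64: "1 / (4 * (p * n)) \<le> 1 / 64" unfolding pn_eq using x by (simp add: field_simps)
  have "q / 4 * T * (1 / 4) \<le> q / 4 * T * (3/4 - 1 / (4 * (p * n)) - 2 * rate
      - 2 * (ln N / (1 / 64) + 1 / 64 * (p * n)) / B)"
  proof (rule mult_left_mono)
    show "1 / 4 \<le> 3/4 - 1 / (4 * (p * n)) - 2 * rate - 2 * (ln N / (1 / 64) + 1 / 64 * (p * n)) / B"
      using rate err x64 by linarith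
  qed (use q in simp)
  also have "\<dots> \<le> eps\<^sup>2 / 20 * real T"
    by (rule regret_lower_bound) (simp, unfold adv_def, intro regret adaptive_hiding_adversary)
  finally have "eps\<^sup>2 * real T * (1 / 4) \<le> eps\<^sup>2 * real T * (1 / 20)" by (simp add: q_def)
  moreover have "0 < eps\<^sup>2 * real T" using eps0 T by simp
  ultimately show False by linarith
qed

theorem theorem6p1:
  fixes word_bits :: "nat \<Rightarrow> nat"
    and S :: "nat \<times> nat \<times> real \<Rightarrow> real"
  assumes "(\<lambda>n. real (word_bits n)) \<in> O(\<lambda>n. ln (real n))"
    and "S \<in> o[large_n](\<lambda>(n, T, eps). sqrt (real n) / (eps * ln (real n) ^ 3))"
  shows "\<forall>\<^sub>F (n, T, eps) in large_n.
    \<not> (\<exists>alg. online_algorithm n (word_bits n) alg \<and>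
          uses_space_at_most n T alg (S (n, T, eps)) \<and>
          (\<forall>adv. adaptive_adversary n adv \<longrightarrow> regret n T alg adv \<le> eps\<^sup>2 / 20 * real T))"
proof -
  obtain C where C: "0 < C" "\<forall>\<^sub>F n in at_top. norm (real (word_bits n)) \<le> C * norm (ln (real n))"
    using landau_o.bigE[OF assms(1)] by blast
  \<comment> \<open>Chosen so that \<open>c\<close> times the constant \<open>C + 1\<close>, which
    bounds \<open>word_bits n + 1\<close> relative to \<open>ln n\<close>, is the 1/10000 of
    \<open>no_small_space_algorithm\<close>.\<close>
  define c where "c = 1 / (10000 * (C + 1))"
  have c: "0 < c" using C by (simp add: c_def)
  have space: "\<forall>\<^sub>F x in large_n. norm (S x)
      \<le> c * norm (case x of (n, T, eps) \<Rightarrow> sqrt (real n) / (eps * ln (real n) ^ 3))"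
    by (rule landau_o.smallD[OF assms(2) c])
  have "\<forall>\<^sub>F n in at_top. 3 \<le> ln (real n)"
    using filterlim_compose[OF ln_at_top filterlim_real_sequentially]
    by (auto simp: filterlim_at_top)
  hence "\<forall>\<^sub>F n in at_top. 64 \<le> n \<and> 3 \<le> ln (real n) \<and> real (word_bits n) \<le> C * ln (real n)"
    using C(2) eventually_ge_at_top[of 64] by eventually_elim auto
  hence "\<forall>\<^sub>F x in filtercomap fst at_top.
      64 \<le> fst x \<and> 3 \<le> ln (real (fst x)) \<and> real (word_bits (fst x)) \<le> C * ln (real (fst x))"
    by (rule eventually_filtercomapI)
  hence large: "\<forall>\<^sub>F x in large_n. x \<in> admissible \<and>
      64 \<le> fst x \<and> 3 \<le> ln (real (fst x)) \<and> real (word_bits (fst x)) \<le> C * ln (real (fst x))"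
    unfolding large_n_def eventually_inf_principal by eventually_elim auto
  from large space show ?thesis
  proof eventually_elim
    case (elim x)
    obtain n T eps where [simp]: "x = (n, T, eps)" by (cases x)
    let ?L = "ln (real n)"
    have adm: "1 \<le> T" "?L ^ 4 / sqrt n < eps" "eps < 1 / 2"
      and n: "64 \<le> n" and L: "3 \<le> ?L" and wb: "real (word_bits n) \<le> C * ?L"
      using elim by (auto simp: admissible_def)
    have "3 ^ 4 \<le> ?L ^ 4" using L by (intro power_mono) auto
    hence "64 / sqrt n \<le> ?L ^ 4 / sqrt n" by (intro divide_right_mono) auto
    hence eps: "64 / sqrt n < eps" using adm by linarith
    have "0 < 64 / sqrt n" using n by simp
    hence eps0: "0 < eps" using eps by linarith
    have "real (word_bits n + 1) * S (n, T, eps) \<le> ((C + 1) * ?L) * \<bar>S (n, T, eps)\<bar>"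
    proof -
      have "real (word_bits n + 1) \<le> (C + 1) * ?L" using wb L by (simp add: algebra_simps)
      hence "real (word_bits n + 1) * \<bar>S (n, T, eps)\<bar> \<le> ((C + 1) * ?L) * \<bar>S (n, T, eps)\<bar>"
        by (rule mult_right_mono) simp
      moreover have "real (word_bits n + 1) * S (n, T, eps) \<le> real (word_bits n + 1) * \<bar>S (n, T, eps)\<bar>"
        by (rule mult_left_mono) auto
      ultimately show ?thesis by linarith
    qed
    also have "\<dots> \<le> ((C + 1) * ?L) * (c * (sqrt n / (eps * ?L ^ 3)))"
      using elim(2) C L eps0 by (intro mult_left_mono) auto
    also have "\<dots> = ((C + 1) * c) * (?L * (sqrt n / (eps * ?L ^ 3)))" by (simp only: mult_ac)
    also have "(C + 1) * c = 1 / 10000" using C by (simp add: c_def)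
    \<comment> \<open>One logarithm pays for the bits of a word; the remaining factor
      \<open>1 / ?L ^ 2\<close> is at most 1.\<close>
    also have "?L * (sqrt n / (eps * ?L ^ 3)) = sqrt n / eps * (1 / ?L ^ 2)"
      using L by (simp add: power2_eq_square power3_eq_cube)
    also have "1 / 10000 * (sqrt n / eps * (1 / ?L ^ 2)) = sqrt n / eps / 10000 * (1 / ?L ^ 2)" by simp
    also have "\<dots> \<le> sqrt n / eps / 10000 * 1"
      using L eps0 by (intro mult_left_mono) (auto simp: field_simps one_le_power)
    finally have "real (word_bits n + 1) * S (n, T, eps) \<le> sqrt n / eps / 10000" by simp
    from no_small_space_algorithm[OF n adm(1) eps adm(3) this] show ?case by (auto simp only: prod.case \<open>x = _\<close>)
  qed
qed

end
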